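(* Let $T>0$, let $N\ge 1$ be an integer, and let $(x_t)_{t\in[0,T]}$ be a standard one-dimensional Brownian motion with known deterministic initial value $x_0$. For a sequence of $(\mathcal F^x_t)$-stopping times $0\le\tau_1\le\dots\le\tau_N\le T$, put $\tau_0=0$, $\tau_{N+1}=T$ and $$J(\tau_1,\dots,\tau_N)=\mathbb E\left[\sum_{i=0}^{N}\int_{\tau_i}^{\tau_{i+1}}(x_s-x_{\tau_i})^2\,ds\right].$$ Define $\theta_0=1$ and, for $k\ge 1$, $$\theta_k=1-\frac{(5+\theta_{k-1})-\sqrt{(5+\theta_{k-1})^2-24}}{4},\qquad \gamma_k=\sqrt{\frac{3(\theta_{k-1}-\theta_k)}{1-\theta_k}}.$$ Then the minimum of $J(\tau_1,\dots,\tau_N)$ over all such sequences of stopping times equals $\theta_N\,\frac{T^2}{2}$, and it is attained by the stopping times defined recursively by $\tau_0^*=0$ and, for $k=1,\dots,N$, $$\tau_k^*=\inf\left\{t\in[\tau_{k-1}^*,T]\;:\;(x_t-x_{\tau_{k-1}^*})^2\ge\gamma_{N-k+1}\,(T-t)\right\}.$$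
   Context: $(\mathcal F^x_t)$ denotes the filtration generated by $x$. $J$ is the aggregate squared error distortion when at most $N$ samples of $x$ are taken on $[0,T]$ at causal times and the state is estimated between samples by holding the last sample value (the initial value $x_0$ before the first sample). A sample time equal to $T$ amounts to an unused sample. *)

theory Defs
  imports "HOL-Probability.Probability"
begin

text \<open>
  Sample paths are continuous for every outcome, not merely almost surely: the filtration
  below is not completed, and pathwise continuity makes first hitting times of closed sets
  stopping times for it. Nothing is assumed about \<open>x\<close> outside \<open>{0..T}\<close>.
\<close>

locale brownian_motion = prob_space M
  for M :: "'a measure" and T :: real and x0 :: real and x :: "real \<Rightarrow> 'a \<Rightarrow> real" +
  assumes measurable_x: "\<And>t. t \<in> {0..T} \<Longrightarrow> x t \<in> borel_measurable M"
    and initial_value: "\<And>\<omega>. \<omega> \<in> space M \<Longrightarrow> x 0 \<omega> = x0"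
    and continuous_paths: "\<And>\<omega>. \<omega> \<in> space M \<Longrightarrow> continuous_on {0..T} (\<lambda>t. x t \<omega>)"
    and normal_increments: "\<And>s t. 0 \<le> s \<Longrightarrow> s < t \<Longrightarrow> t \<le> T \<Longrightarrow>
      distributed M lborel (\<lambda>\<omega>. x t \<omega> - x s \<omega>) (normal_density 0 (sqrt (t - s)))"
    and independent_increments: "\<And>(n::nat) t. 0 \<le> t 0 \<Longrightarrow> (\<And>i. i < n \<Longrightarrow> t i \<le> t (Suc i)) \<Longrightarrow>
      t n \<le> T \<Longrightarrow> indep_vars (\<lambda>_. borel) (\<lambda>i \<omega>. x (t (Suc i)) \<omega> - x (t i) \<omega>) {..<n}"

text \<open>
  Times range over the whole type \<open>real\<close>, as the library's notion of filtration requires;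
  the filtration is trivial before time 0 and constant after time \<open>T\<close>.
\<close>

definition natural_filtration :: "'a measure \<Rightarrow> real \<Rightarrow> (real \<Rightarrow> 'a \<Rightarrow> real) \<Rightarrow> real \<Rightarrow> 'a measure" where
  "natural_filtration M T x t =
     sigma (space M) {x s -` A \<inter> space M | s A. s \<in> {0..min t T} \<and> A \<in> sets borel}"

lemma filtration_natural_filtration: "filtration (space M) (natural_filtration M T x)"
proof
  fix i j :: real
  have sub: "{x s -` A \<inter> space M | s A. s \<in> {0..min t T} \<and> A \<in> sets borel} \<subseteq> Pow (space M)" for t
    by auto
  show "space (natural_filtration M T x i) = space M"
    unfolding natural_filtration_def by (rule space_measure_of[OF sub])
  assume "i \<le> j"
  then show "sets (natural_filtration M T x i) \<subseteq> sets (natural_filtration M T x j)"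
    unfolding natural_filtration_def sets_measure_of[OF sub]
    by (intro sigma_sets_mono') (fastforce intro: order_trans)
qed

text \<open>
  A sampling policy is a family \<open>\<tau>\<close> of which only the entries \<open>\<tau> 1, \<dots>, \<tau> N\<close> matter;
  \<open>sample_time\<close> adds the conventional endpoints \<open>0\<close> and \<open>T\<close>.
\<close>

definition admissible ::
  "'a measure \<Rightarrow> real \<Rightarrow> nat \<Rightarrow> (real \<Rightarrow> 'a \<Rightarrow> real) \<Rightarrow> (nat \<Rightarrow> 'a \<Rightarrow> real) \<Rightarrow> bool" where
  "admissible M T N x \<tau> \<longleftrightarrow>
     (\<forall>k\<in>{1..N}. stopping_time (natural_filtration M T x) (\<tau> k)) \<and>
     (\<forall>\<omega>\<in>space M. 0 \<le> \<tau> 1 \<omega> \<and> (\<forall>k\<in>{1..<N}. \<tau> k \<omega> \<le> \<tau> (k + 1) \<omega>) \<and> \<tau> N \<omega> \<le> T)"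

definition sample_time :: "real \<Rightarrow> nat \<Rightarrow> (nat \<Rightarrow> 'a \<Rightarrow> real) \<Rightarrow> nat \<Rightarrow> 'a \<Rightarrow> real" where
  "sample_time T N \<tau> k \<omega> = (if k = 0 then 0 else if k \<le> N then \<tau> k \<omega> else T)"

definition distortion ::
  "'a measure \<Rightarrow> real \<Rightarrow> nat \<Rightarrow> (real \<Rightarrow> 'a \<Rightarrow> real) \<Rightarrow> (nat \<Rightarrow> 'a \<Rightarrow> real) \<Rightarrow> real" where
  "distortion M T N x \<tau> =
     (LINT \<omega>|M. (\<Sum>i=0..N. LINT s:{sample_time T N \<tau> i \<omega>..sample_time T N \<tau> (i + 1) \<omega>}|lborel.
        (x s \<omega> - x (sample_time T N \<tau> i \<omega>) \<omega>)\<^sup>2))"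

primrec theta :: "nat \<Rightarrow> real" where
  "theta 0 = 1"
| "theta (Suc k) = 1 - ((5 + theta k) - sqrt ((5 + theta k)\<^sup>2 - 24)) / 4"

text \<open>Only meaningful for \<open>k \<ge> 1\<close>.\<close>

definition gamma :: "nat \<Rightarrow> real" where
  "gamma k = sqrt (3 * (theta (k - 1) - theta k) / (1 - theta k))"

text \<open>
  The set below contains \<open>T\<close>, so the infimum is never that of an empty set.
  Only the values at \<open>k \<le> N\<close> are used.
\<close>

primrec optimal_time :: "real \<Rightarrow> nat \<Rightarrow> (real \<Rightarrow> 'a \<Rightarrow> real) \<Rightarrow> nat \<Rightarrow> 'a \<Rightarrow> real" where
  "optimal_time T N x 0 \<omega> = 0"
| "optimal_time T N x (Suc k) \<omega> =
     Inf {t \<in> {optimal_time T N x k \<omega>..T}.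
       (x t \<omega> - x (optimal_time T N x k \<omega>) \<omega>)\<^sup>2 \<ge> gamma (N - Suc k + 1) * (T - t)}"

end

theory Submission
  imports Defs
begin

text \<open>
  Let \<open>y\<close> be the estimation error since the last sample and \<open>d\<close> the remaining time. Two
  polynomial identities of Brownian motion carry the proof: \<open>\<integral>y\<^sup>2 + y\<^sup>2 d + d\<^sup>2 / 2\<close> and the caloric
  polynomial \<open>y^4 + 6 y\<^sup>2 d + 3 d\<^sup>2\<close> are martingales between two sampling times. With
  \<open>A = (1 - \<theta>\<^sub>k) / 6\<close> the combination \<open>A (y^4 + 6 y\<^sup>2 d + 3 d\<^sup>2) - y\<^sup>2 d - (1 - \<theta>\<^sub>k\<^sub>-\<^sub>1) d\<^sup>2 / 2\<close> is the
  perfect square \<open>A (y\<^sup>2 - \<gamma>\<^sub>k d)\<^sup>2\<close>, so optional stopping makes the cost of a stage telescope up to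
  the nonnegative error \<open>A E (y\<^sup>2 - \<gamma>\<^sub>k d)\<^sup>2\<close>. This error vanishes exactly when the next sample is taken
  on the curve \<open>y\<^sup>2 = \<gamma>\<^sub>k d\<close>.
\<close>

text \<open>Sampling times are arbitrary stopping times, and a stage also starts at a random time.
  Optional stopping is therefore proved for a pair \<open>\<sigma>\<close>, \<open>\<tau>\<close>
  with both ends random: the times are rounded up to a uniform grid, the identity is checked cell by
  cell, and the mesh tends to 0 under one integrable bound for the fourth powers of all increments.
  Only unconditional expectations occur. In place of a dynamic programming recursion there is an
  exact cost formula for every admissible policy, from which the lower bound and its attainment are
  both read off.

  The recursion for \<open>theta\<close> comes out of the perfect square. With multiplier
  \<open>A\<close> and slope \<open>g\<close>, matching the coefficients of \<open>y^2 d\<close> and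
  \<open>d^2\<close> gives \<open>A * (2 * g + 6) = 1\<close> and
  \<open>A * g^2 = 3 * A - (1 - theta k) / 2\<close>. For
  \<open>a = 6 * A = 1 - theta (Suc k)\<close>, eliminating \<open>g\<close> leaves
  \<open>2 * a^2 - (5 + theta k) * a + 3 = 0\<close>. The smaller root is the right one: it is at
  most 1, which keeps \<open>g = 3 * (1 - a) / a\<close> nonnegative.\<close>

subsection \<open>Dyadic chaining and Riemann sums along a path\<close>

text \<open>A dyadic point of level \<open>Suc n\<close> either belongs to level \<open>n\<close>
  already or is the right neighbour of such a point, so each level adds at most one increment
  \<open>a n\<close> on the way from 0. The dyadic points \<open>u n\<close> just below
  \<open>t\<close> converge to \<open>t\<close>, and continuity carries the bound over.\<close>

lemma dyadic_chaining:
  fixes f :: "real \<Rightarrow> real"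
  assumes T: "0 < T" and cont: "continuous_on {0..T} f"
    and step: "\<And>n k. k < 2 ^ n \<Longrightarrow>
      \<bar>f (real (Suc k) * T / 2 ^ n) - f (real k * T / 2 ^ n)\<bar> \<le> a n"
    and sum_le: "\<And>n. (\<Sum>m\<le>n. a m) \<le> K"
    and t: "t \<in> {0..T}"
  shows "\<bar>f t - f 0\<bar> \<le> K"
proof -
  have a_nonneg: "0 \<le> a n" for n
    using step[of 0 n] by (smt (verit) zero_less_power zero_less_numeral)
  have grid: "k \<le> 2 ^ n \<Longrightarrow> \<bar>f (real k * T / 2 ^ n) - f 0\<bar> \<le> (\<Sum>m\<le>n. a m)" for n k
  proof (induction n arbitrary: k)
    case 0
    then have "k = 0 \<or> k = 1" by auto
    then show ?case using step[of 0 0] a_nonneg[of 0] by auto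
  next
    case (Suc n)
    have even_case: "\<bar>f (real k * T / 2 ^ Suc n) - f 0\<bar> \<le> (\<Sum>m\<le>n. a m)"
      if "even k" "k \<le> 2 ^ Suc n" for k
    proof -
      obtain j where j: "k = 2 * j" using \<open>even k\<close> by (elim evenE)
      then have "j \<le> 2 ^ n" using that by simp
      from Suc.IH[OF this] show ?thesis by (simp add: j field_simps)
    qed
    show ?case
    proof (cases "even k")
      case True
      then show ?thesis using even_case[of k] Suc.prems a_nonneg[of "Suc n"] by simp
    next
      case False
      then obtain j where j: "k = Suc j" "even j" by (cases k) auto
      then have "j < 2 ^ Suc n" using Suc.prems by simp
      with step[of j "Suc n"] even_case[of j] j show ?thesis by (simp del: power_Suc of_nat_Suc)
    qed
  qed
  define u where "u n = real (nat \<lfloor>t * 2 ^ n / T\<rfloor>) * T / 2 ^ n" for n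
  have floor_nonneg: "0 \<le> t * 2 ^ n / T" for n using t T by simp
  have u_le: "u n \<le> t" for n
  proof -
    have "real (nat \<lfloor>t * 2 ^ n / T\<rfloor>) \<le> t * 2 ^ n / T"
      using floor_nonneg[of n] by (simp add: of_nat_floor)
    then show ?thesis using T by (simp add: u_def field_simps)
  qed
  have u_ge: "t - T * (1 / 2) ^ n \<le> u n" for n
  proof -
    have "t * 2 ^ n / T \<le> real (nat \<lfloor>t * 2 ^ n / T\<rfloor>) + 1"
      using floor_nonneg[of n] by linarith
    then have "t * 2 ^ n / T * (T / 2 ^ n) \<le> (real (nat \<lfloor>t * 2 ^ n / T\<rfloor>) + 1) * (T / 2 ^ n)"
      using T by (intro mult_right_mono) auto
    then show ?thesis using T by (simp add: u_def distrib_right power_one_over add_divide_distrib)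
  qed
  have u_grid: "\<bar>f (u n) - f 0\<bar> \<le> K" for n
  proof -
    have "real (nat \<lfloor>t * 2 ^ n / T\<rfloor>) \<le> t * 2 ^ n / T"
      using floor_nonneg[of n] by (simp add: of_nat_floor)
    also have "\<dots> \<le> 2 ^ n" using t T by (simp add: field_simps)
    finally have "nat \<lfloor>t * 2 ^ n / T\<rfloor> \<le> 2 ^ n"
      by (metis of_nat_le_iff of_nat_numeral of_nat_power)
    from grid[OF this] sum_le[of n] show ?thesis by (simp add: u_def)
  qed
  have "u \<longlonglongrightarrow> t"
  proof (rule tendsto_sandwich[OF always_eventually always_eventually])
    show "\<forall>n. t - T * (1 / 2) ^ n \<le> u n" "\<forall>n. u n \<le> t" using u_ge u_le by auto
    have "(\<lambda>n. t - T * (1 / 2 :: real) ^ n) \<longlonglongrightarrow> t - T * 0"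
      by (intro tendsto_intros) auto
    then show "(\<lambda>n. t - T * (1 / 2) ^ n) \<longlonglongrightarrow> t" by simp
  qed simp
  moreover have "u n \<in> {0..T}" for n
    using u_le[of n] t T by (auto simp: u_def)
  ultimately have "(\<lambda>n. f (u n)) \<longlonglongrightarrow> f t"
    using continuous_on_tendsto_compose[OF cont, of u t sequentially] t by auto
  then have "(\<lambda>n. \<bar>f (u n) - f 0\<bar>) \<longlonglongrightarrow> \<bar>f t - f 0\<bar>" by (intro tendsto_intros)
  then show ?thesis by (rule LIMSEQ_le_const2) (use u_grid in auto)
qed

section \<open>Uniform grids, rounding up, and convergence of Riemann sums\<close>

definition grid_point :: "real \<Rightarrow> nat \<Rightarrow> nat \<Rightarrow> real" where
  "grid_point T n j = real j * T / real (Suc n)"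

text \<open>Rounding goes up, so that a random time has index at most \<open>j\<close> exactly when
  it is at most the grid point \<open>j\<close>. A stopping time rounded in this way is still
  decided by the past.\<close>

definition grid_index :: "real \<Rightarrow> nat \<Rightarrow> real \<Rightarrow> nat" where
  "grid_index T n s = nat \<lceil>s * real (Suc n) / T\<rceil>"

lemma grid_point_0 [simp]: "grid_point T n 0 = 0"
  by (simp add: grid_point_def)

lemma grid_point_last [simp]: "grid_point T n (Suc n) = T"
  by (simp add: grid_point_def)

lemma grid_point_Suc: "grid_point T n (Suc j) = grid_point T n j + T / real (Suc n)"
  by (simp add: grid_point_def distrib_right add_divide_distrib)

lemma grid_point_mono: "0 \<le> T \<Longrightarrow> i \<le> j \<Longrightarrow> grid_point T n i \<le> grid_point T n j"
  by (simp add: grid_point_def divide_right_mono mult_right_mono)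

lemma grid_point_in: "0 \<le> T \<Longrightarrow> j \<le> Suc n \<Longrightarrow> grid_point T n j \<in> {0..T}"
  using grid_point_mono[of T 0 j n] grid_point_mono[of T j "Suc n" n] by simp

lemma grid_index_le_iff:
  assumes "0 < T" shows "grid_index T n s \<le> j \<longleftrightarrow> s \<le> grid_point T n j"
  using assms by (simp add: grid_index_def grid_point_def nat_le_iff ceiling_le_iff field_simps)

lemma grid_index_le: "0 < T \<Longrightarrow> s \<le> T \<Longrightarrow> grid_index T n s \<le> Suc n"
  by (simp add: grid_index_le_iff)

lemma grid_index_mono: "0 < T \<Longrightarrow> s \<le> t \<Longrightarrow> grid_index T n s \<le> grid_index T n t"
  unfolding grid_index_def by (intro nat_mono ceiling_mono divide_right_mono mult_right_mono) auto

lemma grid_point_index_ge: "0 < T \<Longrightarrow> s \<le> grid_point T n (grid_index T n s)"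
  by (simp flip: grid_index_le_iff)

lemma grid_point_index_less:
  assumes "0 < T" "0 \<le> s" shows "grid_point T n (grid_index T n s) < s + T / real (Suc n)"
proof (cases "grid_index T n s")
  case 0
  then show ?thesis using assms by (simp add: add_nonneg_pos)
next
  case (Suc j)
  then have "\<not> grid_index T n s \<le> j" by simp
  then have "grid_point T n j < s" using assms by (simp add: grid_index_le_iff)
  then show ?thesis using Suc by (simp add: grid_point_Suc)
qed

lemma grid_point_index_in:
  "0 < T \<Longrightarrow> s \<in> {0..T} \<Longrightarrow> grid_point T n (grid_index T n s) \<in> {0..T}"
  by (intro grid_point_in grid_index_le) auto

lemma mesh_tendsto_0: "(\<lambda>n. T / real (Suc n)) \<longlonglongrightarrow> 0"
proof -
  have "(\<lambda>n. T * inverse (real (Suc n))) \<longlonglongrightarrow> T * 0"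
    by (intro tendsto_intros LIMSEQ_inverse_real_of_nat)
  then show ?thesis by (simp add: divide_inverse)
qed

lemma grid_point_index_tendsto:
  assumes "0 < T" "0 \<le> s" shows "(\<lambda>n. grid_point T n (grid_index T n s)) \<longlonglongrightarrow> s"
proof (rule tendsto_sandwich[OF always_eventually always_eventually])
  show "\<forall>n. s \<le> grid_point T n (grid_index T n s)" using assms grid_point_index_ge by simp
  show "\<forall>n. grid_point T n (grid_index T n s) \<le> s + T / real (Suc n)"
    using grid_point_index_less[OF assms] by (auto intro: less_imp_le)
  have "(\<lambda>n. s + T / real (Suc n)) \<longlonglongrightarrow> s + 0" by (intro tendsto_intros mesh_tendsto_0)
  then show "(\<lambda>n. s + T / real (Suc n)) \<longlonglongrightarrow> s" by simp
qed simp

text \<open>Not a plain Riemann sum: the endpoints move with \<open>n\<close>, and the squares are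
  centred at the value at the rounded start instead of \<open>f a\<close>. The sum is compared cell
  by cell with the increments of the antiderivative \<open>G\<close> of the limiting integrand;
  continuity of \<open>G\<close> then moves the endpoints.\<close>

lemma grid_sum_tendsto_integral:
  fixes f :: "real \<Rightarrow> real"
  assumes T: "0 < T" and cont: "continuous_on {0..T} f" and a: "0 \<le> a" and ab: "a \<le> b" and b: "b \<le> T"
  shows "(\<lambda>n. \<Sum>j\<in>{grid_index T n a..<grid_index T n b}.
      (f (grid_point T n j) - f (grid_point T n (grid_index T n a)))\<^sup>2 * (T / real (Suc n)))
    \<longlonglongrightarrow> integral {a..b} (\<lambda>s. (f s - f a)\<^sup>2)"
proof -
  define g where "g s = (f s - f a)\<^sup>2" for s
  define G where "G u = integral {0..u} g" for u
  define S where "S n = (\<Sum>j\<in>{grid_index T n a..<grid_index T n b}.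
      (f (grid_point T n j) - f (grid_point T n (grid_index T n a)))\<^sup>2 * (T / real (Suc n)))" for n
  have contg: "continuous_on {0..T} g" unfolding g_def by (intro continuous_intros cont)
  have g_int: "g integrable_on {u..v}" if "0 \<le> u" "v \<le> T" for u v
    by (rule integrable_continuous_real, rule continuous_on_subset[OF contg]) (use that in auto)
  have contG: "continuous_on {0..T} G"
    unfolding G_def by (rule indefinite_integral_continuous_1) (use g_int in auto)
  have G_diff: "G v - G u = integral {u..v} g" if "0 \<le> u" "u \<le> v" "v \<le> T" for u v
    using Henstock_Kurzweil_Integration.integral_combine[of 0 u v g] g_int[of 0 v] that
    by (simp add: G_def)
  obtain B where B: "\<And>s. s \<in> {0..T} \<Longrightarrow> \<bar>f s\<bar> \<le> B"
    using compact_imp_bounded[OF compact_continuous_image[OF cont]] by (fastforce simp: bounded_iff)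
  have "0 \<le> B" using B[of 0] T by force
  have lim_diff: "(\<lambda>n. S n - (G (grid_point T n (grid_index T n b)) - G (grid_point T n (grid_index T n a)))) \<longlonglongrightarrow> 0"
  proof (rule LIMSEQ_I)
    fix e :: real assume "0 < e"
    \<comment> \<open>At most \<open>Suc n\<close> cells with error \<open>8 * B * e1 * h\<close>
      each add up to \<open>8 * B * e1 * T\<close>. The extra 8 makes this strictly less than
      \<open>e\<close> and keeps the denominator positive if \<open>B = 0\<close>.\<close>
    define e1 where "e1 = e / (T * (8 * B + 8))"
    have "0 < e1" using \<open>0 < e\<close> T \<open>0 \<le> B\<close> by (simp add: e1_def)
    have "uniformly_continuous_on {0..T} f"
      by (rule compact_uniformly_continuous[OF cont]) simp
    then obtain d where "0 < d" and d: "\<And>s s'. s \<in> {0..T} \<Longrightarrow> s' \<in> {0..T} \<Longrightarrow> \<bar>s - s'\<bar> < d \<Longrightarrow> \<bar>f s - f s'\<bar> < e1"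
      unfolding uniformly_continuous_on_def dist_real_def using \<open>0 < e1\<close> by metis
    obtain n0 where n0: "\<And>n. n \<ge> n0 \<Longrightarrow> T / real (Suc n) < d"
      using LIMSEQ_D[OF mesh_tendsto_0 \<open>0 < d\<close>, of T] T by auto
    show "\<exists>n0. \<forall>n\<ge>n0. norm (S n - (G (grid_point T n (grid_index T n b)) - G (grid_point T n (grid_index T n a))) - 0) < e"
    proof (intro exI allI impI)
      fix n assume "n \<ge> n0"
      define h where "h = T / real (Suc n)"
      have h: "0 < h" "h < d" using n0[OF \<open>n \<ge> n0\<close>] T by (auto simp: h_def)
      define r where "r = grid_index T n a"
      define q where "q = grid_index T n b"
      have rq: "r \<le> q" "q \<le> Suc n"
        unfolding r_def q_def using grid_index_mono[OF T ab] grid_index_le[OF T b] by auto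
      let ?p = "grid_point T n"
      have pr: "?p r \<in> {0..T}" using rq by (intro grid_point_in) (use T in auto)
      have far: "\<bar>f (?p r) - f a\<bar> < e1"
        using d[OF pr, of a] grid_point_index_ge[OF T, of a n] grid_point_index_less[OF T a, of n] a ab b h
        by (auto simp: r_def h_def)
      have step: "\<bar>(f (?p j) - f (?p r))\<^sup>2 * h - (G (?p (Suc j)) - G (?p j))\<bar> \<le> 8 * B * e1 * h"
        if "j \<in> {r..<q}" for j
      proof -
        have pj: "?p j \<in> {0..T}" "?p (Suc j) \<in> {0..T}"
          using that rq by (auto intro!: grid_point_in simp del: atLeastAtMost_iff simp: T less_imp_le)
        have pS: "?p (Suc j) = ?p j + h" by (simp add: grid_point_Suc h_def)
        have close: "\<bar>(f (?p j) - f (?p r))\<^sup>2 - g s\<bar> \<le> 8 * B * e1" if s: "s \<in> {?p j..?p (Suc j)}" for s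
        proof -
          have sT: "s \<in> {0..T}" using s pj by auto
          have 1: "\<bar>f (?p j) - f s\<bar> < e1" using d[OF pj(1) sT] s pS h by auto
          \<comment> \<open>Factoring the difference of squares separates a small factor, at most
            \<open>2 * e1\<close> by uniform continuity, from one bounded by
            \<open>4 * B\<close>.\<close>
          have "(f (?p j) - f (?p r))\<^sup>2 - g s
             = ((f (?p j) - f s) - (f (?p r) - f a)) * ((f (?p j) - f (?p r)) + (f s - f a))"
            by (simp add: g_def power2_eq_square algebra_simps)
          also have "\<bar>\<dots>\<bar> \<le> (2 * e1) * (4 * B)"
            unfolding abs_mult
          proof (rule mult_mono)
            show "\<bar>f (?p j) - f s - (f (?p r) - f a)\<bar> \<le> 2 * e1" using 1 far by linarith
            show "\<bar>f (?p j) - f (?p r) + (f s - f a)\<bar> \<le> 4 * B"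
              using B[OF pj(1)] B[OF pr] B[OF sT] B[of a] a ab b by simp
          qed (use \<open>0 < e1\<close> in auto)
          finally show ?thesis by (simp add: ac_simps)
        qed
        have gi: "g integrable_on {?p j..?p (Suc j)}" using g_int pj by auto
        have "(f (?p j) - f (?p r))\<^sup>2 * h - (G (?p (Suc j)) - G (?p j))
            = integral {?p j..?p (Suc j)} (\<lambda>s. (f (?p j) - f (?p r))\<^sup>2 - g s)"
          using G_diff[of "?p j" "?p (Suc j)"] pj gi pS h
          by (subst Henstock_Kurzweil_Integration.integral_diff) auto
        also have "\<bar>\<dots>\<bar> \<le> (8 * B * e1) * (?p (Suc j) - ?p j)"
          unfolding real_norm_def[symmetric]
          by (rule integral_bound)
            (use pS h pj close in \<open>auto intro!: continuous_intros continuous_on_subset[OF contg]\<close>)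
        finally show ?thesis by (simp add: pS)
      qed
      have "S n - (G (?p q) - G (?p r)) = (\<Sum>j\<in>{r..<q}. (f (?p j) - f (?p r))\<^sup>2 * h - (G (?p (Suc j)) - G (?p j)))"
        using sum_Suc_diff'[OF rq(1), of "\<lambda>j. G (?p j)"]
        by (simp add: S_def r_def q_def h_def sum_subtractf)
      also have "\<bar>\<dots>\<bar> \<le> (\<Sum>j\<in>{r..<q}. 8 * B * e1 * h)"
        by (rule order_trans[OF sum_abs]) (intro sum_mono step)
      also have "\<dots> = real (q - r) * (8 * B * e1 * h)" by simp
      also have "\<dots> \<le> real (Suc n) * (8 * B * e1 * h)"
        using rq \<open>0 \<le> B\<close> \<open>0 < e1\<close> h by (intro mult_right_mono) auto
      also have "\<dots> = T * (8 * B) * e1" by (simp add: h_def)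
      also have "\<dots> < T * (8 * B + 8) * e1" using \<open>0 < e1\<close> T by (simp add: algebra_simps)
      also have "\<dots> = e" using T \<open>0 \<le> B\<close> by (simp add: e1_def)
      finally show "norm (S n - (G (grid_point T n (grid_index T n b)) - G (grid_point T n (grid_index T n a))) - 0) < e"
        by (simp add: r_def q_def)
    qed
  qed
  have Glim: "(\<lambda>n. G (grid_point T n (grid_index T n s))) \<longlonglongrightarrow> G s" if "s \<in> {0..T}" for s
    using continuous_on_tendsto_compose[OF contG grid_point_index_tendsto[OF T]] grid_point_index_in[OF T that] that
    by auto
  have "(\<lambda>n. (S n - (G (grid_point T n (grid_index T n b)) - G (grid_point T n (grid_index T n a))))
      + (G (grid_point T n (grid_index T n b)) - G (grid_point T n (grid_index T n a)))) \<longlonglongrightarrow> 0 + (G b - G a)"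
    by (intro tendsto_add lim_diff tendsto_diff Glim) (use a ab b in auto)
  then have "S \<longlonglongrightarrow> G b - G a" by simp
  then show ?thesis using G_diff[OF a ab b] by (simp add: S_def[abs_def] g_def[abs_def])
qed

subsection \<open>Independence of the past and moments of Brownian motion\<close>

locale brownian_motion_pos = brownian_motion +
  assumes T_pos: "0 < T"
begin

abbreviation "F \<equiv> natural_filtration M T x"

lemma space_F: "space (F t) = space M"
  using filtration_natural_filtration[of M T x] by (rule filtration.space_F)

lemma sets_F_mono: "s \<le> t \<Longrightarrow> sets (F s) \<subseteq> sets (F t)"
  using filtration_natural_filtration[of M T x] by (rule filtration.sets_F_mono)

lemma sets_F: "sets (F t) = sigma_sets (space M) {x s -` A \<inter> space M | s A. s \<in> {0..min t T} \<and> A \<in> sets borel}"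
  unfolding natural_filtration_def by (rule sets_measure_of) auto

lemma sets_F_subset: "sets (F t) \<subseteq> sets M"
  unfolding sets_F by (rule sets.sigma_sets_subset) (use measurable_x measurable_sets in \<open>fastforce simp del: vimage_Int\<close>)

lemma measurable_F_M: "f \<in> borel_measurable (F s) \<Longrightarrow> f \<in> borel_measurable M"
  by (rule borel_measurable_subalgebra[OF sets_F_subset]) (simp_all add: space_F)

lemma x_measurable_F: "0 \<le> s \<Longrightarrow> s \<le> t \<Longrightarrow> s \<le> T \<Longrightarrow> x s \<in> borel_measurable (F t)"
  by (rule measurableI) (auto simp: space_F sets_F intro!: sigma_sets.Basic)

lemma increment_measurable:
  "s \<in> {0..T} \<Longrightarrow> t \<in> {0..T} \<Longrightarrow> (\<lambda>\<omega>. x t \<omega> - x s \<omega>) \<in> borel_measurable M"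
  by (intro borel_measurable_diff measurable_x)

lemma increment_moment:
  assumes "0 \<le> s" "s < t" "t \<le> T"
  shows "integrable M (\<lambda>\<omega>. (x t \<omega> - x s \<omega>) ^ p)"
    and "expectation (\<lambda>\<omega>. (x t \<omega> - x s \<omega>) ^ p) = (\<integral>y. normal_density 0 (sqrt (t - s)) y * (y - 0) ^ p \<partial>lborel)"
proof -
  note D = normal_increments[OF assms]
  have pos: "0 < sqrt (t - s)" using assms by simp
  show "integrable M (\<lambda>\<omega>. (x t \<omega> - x s \<omega>) ^ p)"
    using distributed_integrable[OF D, of "\<lambda>y. y ^ p"] integrable_normal_moment[OF pos, of 0 p]
    by simp
  show "expectation (\<lambda>\<omega>. (x t \<omega> - x s \<omega>) ^ p) = (\<integral>y. normal_density 0 (sqrt (t - s)) y * (y - 0) ^ p \<partial>lborel)"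
    using distributed_integral[OF D, of "\<lambda>y. y ^ p"] by simp
qed

lemma increment_moments:
  assumes "0 \<le> s" "s < t" "t \<le> T"
  shows "expectation (\<lambda>\<omega>. x t \<omega> - x s \<omega>) = 0"
    and "expectation (\<lambda>\<omega>. (x t \<omega> - x s \<omega>) ^ 2) = t - s"
    and "expectation (\<lambda>\<omega>. (x t \<omega> - x s \<omega>) ^ 3) = 0"
    and "expectation (\<lambda>\<omega>. (x t \<omega> - x s \<omega>) ^ 4) = 3 * (t - s)\<^sup>2"
proof -
  have pos: "0 < sqrt (t - s)" using assms by simp
  show "expectation (\<lambda>\<omega>. x t \<omega> - x s \<omega>) = 0"
    using increment_moment(2)[OF assms, of 1] integral_normal_moment_odd[OF pos, of 0 0] by simp
  show "expectation (\<lambda>\<omega>. (x t \<omega> - x s \<omega>) ^ 3) = 0"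
    using increment_moment(2)[OF assms, of 3] integral_normal_moment_odd[OF pos, of 0 1] by simp
  show "expectation (\<lambda>\<omega>. (x t \<omega> - x s \<omega>) ^ 2) = t - s"
    using increment_moment(2)[OF assms, of 2] integral_normal_moment_even[OF pos, of 0 1] assms
    by (simp add: fact_numeral)
  show "expectation (\<lambda>\<omega>. (x t \<omega> - x s \<omega>) ^ 4) = 3 * (t - s)\<^sup>2"
    using increment_moment(2)[OF assms, of 4] integral_normal_moment_even[OF pos, of 0 2] assms
    by (simp add: fact_numeral power2_eq_square field_simps)
qed

text \<open>Independence is assumed only for increments along an increasing chain of times. The past
  times are therefore sorted into such a chain that ends with the step from \<open>s\<close> to
  \<open>t\<close>. A past value is \<open>x0\<close> plus a sum of increments before this last
  step, so the two events depend on disjoint blocks of independent variables.\<close>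

lemma finite_past_indep_increment:
  assumes st: "0 \<le> s" "s < t" "t \<le> T"
    and S: "finite S" "S \<subseteq> {0..s}"
    and C: "\<And>u. u \<in> S \<Longrightarrow> C u \<in> sets borel" and A: "A \<in> sets borel"
  shows "prob ({\<omega> \<in> space M. \<forall>u\<in>S. x u \<omega> \<in> C u} \<inter> ((\<lambda>\<omega>. x t \<omega> - x s \<omega>) -` A \<inter> space M))
    = prob {\<omega> \<in> space M. \<forall>u\<in>S. x u \<omega> \<in> C u} * prob ((\<lambda>\<omega>. x t \<omega> - x s \<omega>) -` A \<inter> space M)"
proof -
  \<comment> \<open>Inserting 0 lets the values be rebuilt from the increments and
    \<open>x0\<close>; inserting \<open>s\<close> makes the final increment start exactly at
    \<open>s\<close>.\<close>
  define l where "l = sorted_list_of_set (insert 0 (insert s S))"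
  have l: "sorted l" "set l = insert 0 (insert s S)" using S by (auto simp: l_def simp del: sorted_list_of_set.sorted_key_list_of_set_insert_remove)
  define m where "m = length l"
  have "0 < m" using l by (auto simp: m_def)
  define v where "v i = (if i < m then l ! i else t)" for i
  have l_in: "l ! i \<in> {0..s}" if "i < m" for i
    using nth_mem[of i l] that l S st by (auto simp: m_def)
  have v0: "v 0 = 0"
  proof -
    obtain i where i: "i < m" "l ! i = 0" using l by (metis in_set_conv_nth insertI1 m_def)
    then have "l ! 0 \<le> 0" using sorted_nth_mono[OF l(1), of 0 i] by (simp add: m_def)
    then show ?thesis using l_in[OF \<open>0 < m\<close>] \<open>0 < m\<close> by (simp add: v_def)
  qed
  have vlast: "v (m - 1) = s"
  proof -
    obtain i where i: "i < m" "l ! i = s" using l by (metis in_set_conv_nth insertI1 insertI2 m_def)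
    then have "s \<le> l ! (m - 1)" using sorted_nth_mono[OF l(1), of i "m - 1"] by (simp add: m_def)
    then show ?thesis using l_in[of "m - 1"] \<open>0 < m\<close> by (simp add: v_def)
  qed
  have vm: "v m = t" by (simp add: v_def)
  have v_mono: "v i \<le> v (Suc i)" if "i < m" for i
    using that l_in[of i] sorted_nth_mono[OF l(1), of i "Suc i"] st by (auto simp: v_def m_def)
  have v_in: "v i \<in> {0..T}" for i using l_in[of i] st by (auto simp: v_def)
  define X where "X i \<omega> = x (v (Suc i)) \<omega> - x (v i) \<omega>" for i \<omega>
  have "indep_vars (\<lambda>_. borel) X {..<m}"
    unfolding X_def by (rule independent_increments) (use v0 v_mono vm st in auto)
  then have ind: "indep_var (PiM {..<m - 1} (\<lambda>_. borel)) (\<lambda>\<omega>. restrict (\<lambda>i. X i \<omega>) {..<m - 1})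
      (PiM {m - 1} (\<lambda>_. borel)) (\<lambda>\<omega>. restrict (\<lambda>i. X i \<omega>) {m - 1})"
    by (rule indep_var_restrict) (use \<open>0 < m\<close> in auto)
  have path: "x (v i) \<omega> = x0 + (\<Sum>j<i. X j \<omega>)" if "\<omega> \<in> space M" for i \<omega>
    using sum_lessThan_telescope[of "\<lambda>j. x (v j) \<omega>" i] initial_value[OF that] v0
    by (simp add: X_def)
  \<comment> \<open>Since \<open>idx u < m\<close>, the sum over \<open>j < idx u\<close> uses only
    indices below \<open>m - 1\<close> and leaves out the final increment.\<close>
  define idx where "idx u = (SOME i. i < m \<and> l ! i = u)" for u
  have idx: "idx u < m" "v (idx u) = u" if "u \<in> S" for u
  proof -
    have "\<exists>i. i < m \<and> l ! i = u" using that l by (metis in_set_conv_nth insertI2 m_def)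
    then have "idx u < m \<and> l ! idx u = u" unfolding idx_def by (rule someI_ex)
    then show "idx u < m" "v (idx u) = u" by (auto simp: v_def)
  qed
  define P where "P = {f \<in> space (PiM {..<m - 1} (\<lambda>_. borel :: real measure)). \<forall>u\<in>S. x0 + (\<Sum>j<idx u. f j) \<in> C u}"
  define Q where "Q = {f \<in> space (PiM {m - 1} (\<lambda>_. borel :: real measure)). f (m - 1) \<in> A}"
  have P: "P \<in> sets (PiM {..<m - 1} (\<lambda>_. borel))"
    unfolding P_def
  proof (rule sets.sets_Collect_finite_All[OF _ S(1)])
    fix u assume u: "u \<in> S"
    have "(\<lambda>f. x0 + (\<Sum>j<idx u. f j)) \<in> borel_measurable (PiM {..<m - 1} (\<lambda>_. borel :: real measure))"
      using idx(1)[OF u]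
      by (intro borel_measurable_add borel_measurable_const borel_measurable_sum measurable_component_singleton) auto
    from measurable_sets[OF this C[OF u]]
    show "{f \<in> space (PiM {..<m - 1} (\<lambda>_. borel)). x0 + (\<Sum>j<idx u. f j) \<in> C u} \<in> sets (PiM {..<m - 1} (\<lambda>_. borel))"
      by (simp add: vimage_def Int_def conj_commute)
  qed
  have Q: "Q \<in> sets (PiM {m - 1} (\<lambda>_. borel))"
    using measurable_sets[OF measurable_component_singleton[of "m - 1" "{m - 1}" "\<lambda>_. borel"] A]
    by (simp add: Q_def vimage_def Int_def conj_commute)
  have eP: "(\<lambda>\<omega>. restrict (\<lambda>i. X i \<omega>) {..<m - 1}) -` P \<inter> space M = {\<omega> \<in> space M. \<forall>u\<in>S. x u \<omega> \<in> C u}"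
  proof -
    have "x0 + (\<Sum>j<idx u. restrict (\<lambda>i. X i \<omega>) {..<m - 1} j) = x u \<omega>" if "\<omega> \<in> space M" "u \<in> S" for \<omega> u
    proof -
      have "(\<Sum>j<idx u. restrict (\<lambda>i. X i \<omega>) {..<m - 1} j) = (\<Sum>j<idx u. X j \<omega>)"
        using idx(1)[OF that(2)] by (intro sum.cong) auto
      then show ?thesis using path[OF that(1), of "idx u"] idx(2)[OF that(2)] by simp
    qed
    then show ?thesis by (auto simp: P_def space_PiM)
  qed
  have eQ: "(\<lambda>\<omega>. restrict (\<lambda>i. X i \<omega>) {m - 1}) -` Q \<inter> space M = (\<lambda>\<omega>. x t \<omega> - x s \<omega>) -` A \<inter> space M"
    using \<open>0 < m\<close> by (auto simp: Q_def space_PiM X_def vlast[simplified] vm)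
  show ?thesis
    using indep_varD[OF ind P Q] unfolding eP[symmetric] eQ[symmetric]
    by (simp add: vimage_def Int_def conj_ac)
qed

text \<open>Finite cylinder events form an intersection-stable generator of the past, so
  independence extends from them to the generated sigma-algebras.\<close>

lemma past_indep_increment:
  assumes st: "0 \<le> s" "s < t" "t \<le> T"
  shows "indep_set (sets (F s)) (sigma_sets (space M) {(\<lambda>\<omega>. x t \<omega> - x s \<omega>) -` A \<inter> space M | A. A \<in> sets borel})"
proof -
  define P where "P = {{\<omega> \<in> space M. \<forall>u\<in>S. x u \<omega> \<in> C u} | S C.
    finite S \<and> S \<subseteq> {0..s} \<and> (\<forall>u\<in>S. C u \<in> sets borel)}"
  define Q where "Q = {(\<lambda>\<omega>. x t \<omega> - x s \<omega>) -` A \<inter> space M | A. A \<in> sets borel}"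
  have Int_P: "Int_stable P"
  proof (rule Int_stableI)
    fix a b assume "a \<in> P" "b \<in> P"
    then obtain S C S' C' where a: "a = {\<omega> \<in> space M. \<forall>u\<in>S. x u \<omega> \<in> C u}" "finite S" "S \<subseteq> {0..s}" "\<forall>u\<in>S. C u \<in> sets borel"
      and b: "b = {\<omega> \<in> space M. \<forall>u\<in>S'. x u \<omega> \<in> C' u}" "finite S'" "S' \<subseteq> {0..s}" "\<forall>u\<in>S'. C' u \<in> sets borel"
      unfolding P_def by blast
    \<comment> \<open>The two cylinders may constrain different times; \<open>UNIV\<close> stands
      for a missing constraint.\<close>
    define D where "D u = (if u \<in> S then C u else UNIV) \<inter> (if u \<in> S' then C' u else UNIV)" for u
    have "a \<inter> b = {\<omega> \<in> space M. \<forall>u\<in>S \<union> S'. x u \<omega> \<in> D u}"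
      unfolding a(1) b(1) D_def by auto
    moreover have "\<forall>u\<in>S \<union> S'. D u \<in> sets borel" using a(4) b(4) by (auto simp: D_def)
    ultimately show "a \<inter> b \<in> P" unfolding P_def using a(2,3) b(2,3)
      by (intro CollectI exI[of _ "S \<union> S'"] exI[of _ D]) auto
  qed
  have Int_Q: "Int_stable Q"
  proof (rule Int_stableI)
    fix a b assume "a \<in> Q" "b \<in> Q"
    then obtain A B where "a = (\<lambda>\<omega>. x t \<omega> - x s \<omega>) -` A \<inter> space M" "b = (\<lambda>\<omega>. x t \<omega> - x s \<omega>) -` B \<inter> space M"
      "A \<in> sets borel" "B \<in> sets borel" unfolding Q_def by blast
    then show "a \<inter> b \<in> Q" unfolding Q_def by (intro CollectI exI[of _ "A \<inter> B"]) auto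
  qed
  have P_events: "P \<subseteq> events"
  proof
    fix a assume "a \<in> P"
    then obtain S C where a: "a = {\<omega> \<in> space M. \<forall>u\<in>S. x u \<omega> \<in> C u}" "finite S" "S \<subseteq> {0..s}" "\<forall>u\<in>S. C u \<in> sets borel"
      unfolding P_def by blast
    have "{\<omega> \<in> space M. x u \<omega> \<in> C u} \<in> events" if "u \<in> S" for u
      using measurable_sets[OF measurable_x, of u "C u"] that a st
      by (auto simp: vimage_def Int_def conj_commute)
    then show "a \<in> events" unfolding a(1) using a(2) by (intro sets.sets_Collect_finite_All) auto
  qed
  have Q_events: "Q \<subseteq> events"
    using measurable_sets[OF increment_measurable[of s t]] st by (auto simp: Q_def)
  have "indep_set P Q"
  proof (rule indep_setI[OF P_events Q_events])
    fix a b assume "a \<in> P" "b \<in> Q"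
    then show "prob (a \<inter> b) = prob a * prob b"
      unfolding P_def Q_def using finite_past_indep_increment[OF st] by blast
  qed
  then have "indep_set (sigma_sets (space M) P) (sigma_sets (space M) Q)"
    by (rule indep_set_sigma_sets[OF _ Int_P Int_Q])
  moreover have "sets (F s) \<subseteq> sigma_sets (space M) P"
    unfolding sets_F
  proof (rule sigma_sets_subseteq, safe)
    fix u A assume "u \<in> {0..min s T}" "A \<in> sets (borel :: real measure)"
    then show "x u -` A \<inter> space M \<in> P"
      unfolding P_def by (intro CollectI exI[of _ "{u}"] exI[of _ "\<lambda>_. A"]) auto
  qed
  ultimately show ?thesis
    unfolding indep_set_def Q_def by (elim indep_sets_mono_sets) (auto split: bool.split)
qed

text \<open>This takes the place of conditioning on \<open>F s\<close>: a factor known at time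
  \<open>s\<close> splits off from a function of the next increment, so the product has mean 0 as
  soon as that function has.\<close>

lemma past_times_increment:
  assumes st: "0 \<le> s" "s < t" "t \<le> T"
    and G: "G \<in> borel_measurable (F s)" "integrable M G"
    and f: "f \<in> borel_measurable borel" "integrable M (\<lambda>\<omega>. f (x t \<omega> - x s \<omega>) :: real)"
  shows "integrable M (\<lambda>\<omega>. G \<omega> * f (x t \<omega> - x s \<omega>))"
    and "expectation (\<lambda>\<omega>. G \<omega> * f (x t \<omega> - x s \<omega>)) = expectation G * expectation (\<lambda>\<omega>. f (x t \<omega> - x s \<omega>))"
proof -
  have GM: "G \<in> borel_measurable M" using G(1) by (rule measurable_F_M)
  have "indep_var borel G borel (\<lambda>\<omega>. x t \<omega> - x s \<omega>)"
    unfolding indep_var_eq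
  proof (intro conjI GM increment_measurable)
    have "sigma_sets (space M) {G -` A \<inter> space M |A. A \<in> sets borel} \<subseteq> sets (F s)"
      using sets.sigma_sets_subset[of _ "F s"] measurable_sets[OF G(1)]
      by (auto simp: space_F intro!: sets.sigma_sets_subset[of _ "F s", unfolded space_F])
    then show "indep_set (sigma_sets (space M) {G -` A \<inter> space M |A. A \<in> sets borel})
      (sigma_sets (space M) {(\<lambda>\<omega>. x t \<omega> - x s \<omega>) -` A \<inter> space M |A. A \<in> sets borel})"
      using past_indep_increment[OF st] unfolding indep_set_def
      by (elim indep_sets_mono_sets) (auto split: bool.split)
  qed (use st in auto)
  from indep_var_compose[OF this, of "\<lambda>g. g" borel f borel] f(1)
  have ind: "indep_var borel G borel (\<lambda>\<omega>. f (x t \<omega> - x s \<omega>))" by (simp add: comp_def)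
  show "integrable M (\<lambda>\<omega>. G \<omega> * f (x t \<omega> - x s \<omega>))"
    by (rule indep_var_integrable[OF ind G(2) f(2)])
  show "expectation (\<lambda>\<omega>. G \<omega> * f (x t \<omega> - x s \<omega>)) = expectation G * expectation (\<lambda>\<omega>. f (x t \<omega> - x s \<omega>))"
    by (rule indep_var_lebesgue_integral[OF ind G(2) f(2)])
qed

text \<open>
  A dyadic increment of level \<open>n\<close> has fourth moment of order \<open>4\<^sup>-\<^sup>n\<close> and there are \<open>2\<^sup>n\<close> of them, so
  their sum still has finite expectation after weighting with \<open>c\<^sup>n\<close> for \<open>1 < c < 2\<close>; here
  \<open>c = (11/10)^4\<close>. Chaining then avoids any maximal inequality.
\<close>

lemma fourth_moment_dominated:
  obtains W where "integrable M W" and "\<And>\<omega>. 0 \<le> W \<omega>"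
    and "AE \<omega> in M. \<forall>s\<in>{0..T}. \<forall>t\<in>{0..T}. (x t \<omega> - x s \<omega>) ^ 4 \<le> W \<omega>"
proof -
  define \<rho> :: real where "\<rho> = 11 / 10"
  define \<Delta> where "\<Delta> n k \<omega> = x (real (Suc k) * T / 2 ^ n) \<omega> - x (real k * T / 2 ^ n) \<omega>" for n k \<omega>
  define w where "w n \<omega> = (\<rho> ^ 4) ^ n * (\<Sum>k<2 ^ n. \<Delta> n k \<omega> ^ 4)" for n \<omega>
  have ord: "0 \<le> real k * T / 2 ^ n" "real k * T / 2 ^ n < real (Suc k) * T / 2 ^ n" "real (Suc k) * T / 2 ^ n \<le> T"
    if "k < 2 ^ n" for k n
  proof -
    have "real (Suc k) \<le> 2 ^ n" using that by (metis Suc_leI of_nat_le_iff of_nat_numeral of_nat_power)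
    then show "real (Suc k) * T / 2 ^ n \<le> T"
      using T_pos by (simp add: pos_divide_le_eq mult.commute[of _ T] del: of_nat_Suc)
  qed (use T_pos in \<open>auto simp: field_simps\<close>)
  have len: "real (Suc k) * T / 2 ^ n - real k * T / 2 ^ n = T / 2 ^ n" for k n
    by (simp add: distrib_right add_divide_distrib)
  have \<Delta>: "integrable M (\<lambda>\<omega>. \<Delta> n k \<omega> ^ 4)" "expectation (\<lambda>\<omega>. \<Delta> n k \<omega> ^ 4) = 3 * (T / 2 ^ n)\<^sup>2"
    if "k < 2 ^ n" for n k
    using increment_moment(1)[OF ord[OF that], of 4] increment_moments(4)[OF ord[OF that]]
    unfolding \<Delta>_def len by auto
  have w_int: "integrable M (w n)" for n
    unfolding w_def using \<Delta>(1) by (intro integrable_mult_right integrable_sum) auto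
  have w_nonneg: "0 \<le> w n \<omega>" for n \<omega>
    unfolding w_def by (intro mult_nonneg_nonneg sum_nonneg) (auto simp: \<rho>_def)
  have w_exp: "expectation (w n) = 3 * T\<^sup>2 * (\<rho> ^ 4 / 2) ^ n" for n
  proof -
    have "expectation (w n) = (\<rho> ^ 4) ^ n * (\<Sum>k<(2::nat) ^ n. 3 * (T / 2 ^ n)\<^sup>2)"
      unfolding w_def using \<Delta> by (simp add: Bochner_Integration.integral_sum)
    then show ?thesis by (simp add: power_divide power2_eq_square)
  qed
  \<comment> \<open>The ratio is \<open>\<rho> ^ 4 / 2\<close>, and \<open>1.1 ^ 4 = 1.4641\<close>
    is below 2.\<close>
  have summ: "summable (\<lambda>n. expectation (w n))"
    unfolding w_exp by (intro summable_mult summable_geometric) (simp add: \<rho>_def power_divide)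
  have AE_summ: "AE \<omega> in M. summable (\<lambda>n. w n \<omega>)"
  proof -
    have "(\<integral>\<^sup>+\<omega>. (\<Sum>n. ennreal (w n \<omega>)) \<partial>M) = (\<Sum>n. \<integral>\<^sup>+\<omega>. ennreal (w n \<omega>) \<partial>M)"
      using w_int by (intro nn_integral_suminf) auto
    also have "\<dots> = (\<Sum>n. ennreal (expectation (w n)))"
      using w_int w_nonneg by (intro suminf_cong nn_integral_eq_integral) auto
    also have "\<dots> = ennreal (\<Sum>n. expectation (w n))"
      using w_nonneg by (intro suminf_ennreal2 summ integral_nonneg) auto
    finally have "(\<integral>\<^sup>+\<omega>. (\<Sum>n. ennreal (w n \<omega>)) \<partial>M) \<noteq> \<infinity>" by simp
    moreover have "(\<lambda>\<omega>. \<Sum>n. ennreal (w n \<omega>)) \<in> borel_measurable M"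
      using borel_measurable_integrable[OF w_int] by measurable
    ultimately have "AE \<omega> in M. (\<Sum>n. ennreal (w n \<omega>)) \<noteq> \<infinity>"
      by (intro nn_integral_noteq_infinite)
    then show ?thesis
    proof (eventually_elim)
      case (elim \<omega>)
      then show ?case using w_nonneg by (intro summable_suminf_not_top) auto
    qed
  qed
  define V where "V \<omega> = (\<Sum>n. w n \<omega>)" for \<omega>
  have V_int: "integrable M V"
    unfolding V_def
    by (rule integrable_suminf) (use w_int w_nonneg AE_summ summ in auto)
  \<comment> \<open>The geometric series with ratio \<open>1 / \<rho> = 10 / 11\<close> has sum 11,
    and \<open>s\<close> and \<open>t\<close> are each compared with time 0, which doubles it to
    22.\<close>
  have bound: "(x t \<omega> - x s \<omega>) ^ 4 \<le> 22 ^ 4 * V \<omega>"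
    if \<omega>: "\<omega> \<in> space M" and S: "summable (\<lambda>n. w n \<omega>)" and st: "s \<in> {0..T}" "t \<in> {0..T}" for s t \<omega>
  proof -
    have V0: "0 \<le> V \<omega>" unfolding V_def using w_nonneg S by (intro suminf_nonneg) auto
    define v where "v = root 4 (V \<omega>)"
    have v: "0 \<le> v" "v ^ 4 = V \<omega>" using V0 by (auto simp: v_def)
    have step: "\<bar>\<Delta> n k \<omega>\<bar> \<le> v * (1 / \<rho>) ^ n" if "k < 2 ^ n" for n k
    proof -
      have "(\<rho> ^ 4) ^ n * \<Delta> n k \<omega> ^ 4 \<le> w n \<omega>"
        unfolding w_def using that by (intro mult_left_mono member_le_sum) (auto simp: \<rho>_def)
      also have "\<dots> \<le> V \<omega>"
        unfolding V_def using sum_le_suminf[OF S, of "{n}"] w_nonneg by simp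
      finally have "(\<rho> ^ n * \<bar>\<Delta> n k \<omega>\<bar>) ^ 4 \<le> v ^ 4"
        by (simp add: v power_mult_distrib flip: power_mult) (simp add: mult.commute)
      then have "\<rho> ^ n * \<bar>\<Delta> n k \<omega>\<bar> \<le> v"
        using v(1) by (rule power_le_imp_le_base[of _ 3, simplified])
      moreover have "0 < \<rho> ^ n" by (simp add: \<rho>_def)
      ultimately show ?thesis by (simp add: power_one_over field_simps)
    qed
    have sum_le: "(\<Sum>m\<le>n. v * (1 / \<rho>) ^ m) \<le> 11 * v" for n
    proof -
      have "(\<Sum>m\<le>n. (1 / \<rho>) ^ m) \<le> (\<Sum>m. (1 / \<rho>) ^ m)"
        by (intro sum_le_suminf summable_geometric) (auto simp: \<rho>_def)
      also have "\<dots> = 11" by (subst suminf_geometric) (auto simp: \<rho>_def)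
      finally show ?thesis using v(1) by (simp add: mult_left_mono mult.commute flip: sum_distrib_left)
    qed
    have "\<bar>x u \<omega> - x 0 \<omega>\<bar> \<le> 11 * v" if "u \<in> {0..T}" for u
      by (rule dyadic_chaining[OF T_pos continuous_paths[OF \<omega>] step[unfolded \<Delta>_def] sum_le that])
    from this[OF st(1)] this[OF st(2)] have "\<bar>x t \<omega> - x s \<omega>\<bar> \<le> 22 * v" by linarith
    then have "\<bar>x t \<omega> - x s \<omega>\<bar> ^ 4 \<le> (22 * v) ^ 4" by (intro power_mono) auto
    then show ?thesis by (simp add: power_mult_distrib v)
  qed
  show thesis
  \<comment> \<open>Where the series diverges, \<open>V\<close> is an unspecified real; the absolute
    value makes the bound nonnegative for every outcome.\<close>
  proof (rule that[of "\<lambda>\<omega>. \<bar>22 ^ 4 * V \<omega>\<bar>"])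
    show "integrable M (\<lambda>\<omega>. \<bar>22 ^ 4 * V \<omega>\<bar>)" using V_int by auto
    show "AE \<omega> in M. \<forall>s\<in>{0..T}. \<forall>t\<in>{0..T}. (x t \<omega> - x s \<omega>) ^ 4 \<le> \<bar>22 ^ 4 * V \<omega>\<bar>"
      using AE_summ AE_space
    proof (eventually_elim)
      case (elim \<omega>)
      then show ?case using bound[of \<omega>] by (smt (verit))
    qed
  qed auto
qed

end

subsection \<open>Optional stopping\<close>

lemma nat_measurable_leI:
  fixes g :: "'b \<Rightarrow> nat"
  assumes "\<And>i. {\<omega> \<in> space N. g \<omega> \<le> i} \<in> sets N"
  shows "g \<in> measurable N (count_space UNIV)"
proof (subst measurable_count_space_eq2_countable, safe)
  fix i
  have "g -` {i} \<inter> space N = {\<omega> \<in> space N. g \<omega> \<le> i} - (if i = 0 then {} else {\<omega> \<in> space N. g \<omega> \<le> i - 1})"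
    by auto
  also have "\<dots> \<in> sets N" using assms[of i] assms[of "i - 1"] by (intro sets.Diff) auto
  finally show "g -` {i} \<inter> space N \<in> sets N" .
qed auto

text \<open>Through this inequality the single dominating variable for fourth powers controls all
  lower moments as well.\<close>

lemma abs_power_le_1_plus_power4:
  fixes y :: real
  assumes "k \<le> 4" shows "\<bar>y ^ k\<bar> \<le> 1 + y ^ 4"
proof (cases "\<bar>y\<bar> \<le> 1")
  case True
  then have "\<bar>y\<bar> ^ k \<le> 1" by (simp add: power_le_one)
  then show ?thesis by (simp add: power_abs add_increasing2)
next
  case False
  then have "\<bar>y\<bar> ^ k \<le> \<bar>y\<bar> ^ 4" using assms by (intro power_increasing) auto
  then show ?thesis by (simp add: power_abs)
qed

text \<open>
  The term \<open>d * (d - h) / 2\<close> in place of \<open>d\<^sup>2 / 2\<close> makes the optional stopping identity exact on a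
  grid of mesh \<open>h\<close>, where the running cost is a Riemann sum.
\<close>

definition potential :: "real \<Rightarrow> real \<Rightarrow> real \<Rightarrow> real \<Rightarrow> real" where
  "potential A h y d = y\<^sup>2 * d + d * (d - h) / 2 - A * (y ^ 4 + 6 * y\<^sup>2 * d + 3 * d\<^sup>2)"

text \<open>The discrete martingale property in algebraic form: on the right, powers of
  \<open>y\<close> multiply only \<open>z\<close>, \<open>z^2 - h\<close>, \<open>z^3\<close> and
  \<open>z^4 - 3 * h^2\<close>, and each of these has mean 0 when \<open>z\<close> is normal with
  mean 0 and variance \<open>h\<close>.\<close>

lemma potential_step:
  "y\<^sup>2 * h + potential A h (y + z) (d - h) - potential A h y d
    = (2 - 12 * A) * (d - h) * (y * z) + (1 - 6 * A) * (d - h) * (z\<^sup>2 - h)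
      - 4 * A * (y ^ 3 * z) - 6 * A * (y\<^sup>2 * (z\<^sup>2 - h)) - 4 * A * (y * z ^ 3) - A * (z ^ 4 - 3 * h\<^sup>2)"
  unfolding potential_def by (simp add: power2_eq_square power3_eq_cube power4_eq_xxxx field_simps)

context brownian_motion_pos
begin

text \<open>The measure \<open>N\<close> is left open because the lemma serves both for
  \<open>M\<close> and for the past \<open>F t\<close>. The grid is laid on \<open>{0..t}\<close>
  with last point \<open>t\<close>, so rounding up never looks beyond \<open>t\<close>; path
  continuity gives the limit.\<close>

lemma measurable_x_at_random_time:
  assumes \<sigma>: "\<sigma> \<in> borel_measurable N" and range: "\<And>\<omega>. \<omega> \<in> space N \<Longrightarrow> \<sigma> \<omega> \<in> {0..t}"
    and t: "0 < t" "t \<le> T" and N: "space N = space M"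
    and meas: "\<And>s. s \<in> {0..t} \<Longrightarrow> x s \<in> borel_measurable N"
  shows "(\<lambda>\<omega>. x (\<sigma> \<omega>) \<omega>) \<in> borel_measurable N"
proof (rule borel_measurable_LIMSEQ_real)
  fix n
  let ?g = "\<lambda>\<omega>. grid_index t n (\<sigma> \<omega>)"
  have "?g \<in> measurable N (count_space UNIV)"
    unfolding grid_index_le_iff[OF t(1)] using \<sigma> by (intro nat_measurable_leI) (simp add: grid_index_le_iff[OF t(1)])
  then have g: "?g \<in> measurable N (count_space {..Suc n})"
    using range t by (subst measurable_count_space_eq2_countable)
      (auto simp: measurable_count_space_eq2_countable grid_index_le)
  show "(\<lambda>\<omega>. x (grid_point t n (grid_index t n (\<sigma> \<omega>))) \<omega>) \<in> borel_measurable N"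
    by (rule measurable_compose_countable'[OF _ g]) (use t in \<open>auto intro!: meas grid_point_in simp del: atLeastAtMost_iff\<close>)
next
  fix \<omega> assume \<omega>: "\<omega> \<in> space N"
  have "continuous_on {0..t} (\<lambda>s. x s \<omega>)"
    using continuous_paths[of \<omega>] \<omega> N t by (auto intro: continuous_on_subset)
  from continuous_on_tendsto_compose[OF this grid_point_index_tendsto[OF t(1)]]
  show "(\<lambda>n. x (grid_point t n (grid_index t n (\<sigma> \<omega>))) \<omega>) \<longlonglongrightarrow> x (\<sigma> \<omega>) \<omega>"
    using grid_point_index_in[OF t(1)] range[OF \<omega>] by auto
qed

text \<open>Up to a telescoping sum, \<open>D\<close> is a sum over all grid cells of the cost plus
  the change of potential in that cell, switched on by an indicator known at the left end of the
  cell. By \<open>potential_step\<close> each such term is a combination of past factors times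
  centred functions of the next increment.\<close>

lemma grid_optional_stopping:
  fixes n :: nat and A :: real
  assumes \<sigma>: "stopping_time F \<sigma>" and \<tau>: "stopping_time F \<tau>"
    and range: "\<And>\<omega>. \<omega> \<in> space M \<Longrightarrow> 0 \<le> \<sigma> \<omega> \<and> \<sigma> \<omega> \<le> \<tau> \<omega> \<and> \<tau> \<omega> \<le> T"
  defines "p \<equiv> grid_point T n" and "h \<equiv> T / real (Suc n)"
    and "r \<equiv> \<lambda>\<omega>. grid_index T n (\<sigma> \<omega>)" and "q \<equiv> \<lambda>\<omega>. grid_index T n (\<tau> \<omega>)"
  defines "D \<equiv> \<lambda>\<omega>. (\<Sum>j\<in>{r \<omega>..<q \<omega>}. (x (p j) \<omega> - x (p (r \<omega>)) \<omega>)\<^sup>2 * h)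
      + potential A h (x (p (q \<omega>)) \<omega> - x (p (r \<omega>)) \<omega>) (T - p (q \<omega>)) - potential A h 0 (T - p (r \<omega>))"
  shows "integrable M D" and "expectation D = 0"
proof -
  obtain W where W: "integrable M W" "\<And>\<omega>. 0 \<le> W \<omega>"
    "AE \<omega> in M. \<forall>s\<in>{0..T}. \<forall>t\<in>{0..T}. (x t \<omega> - x s \<omega>) ^ 4 \<le> W \<omega>"
    using fourth_moment_dominated by blast
  have h: "0 < h" using T_pos by (simp add: h_def)
  have p_in: "j \<le> Suc n \<Longrightarrow> p j \<in> {0..T}" for j
    unfolding p_def using grid_point_in[of T j n] T_pos by simp
  have p_Suc: "p (Suc j) = p j + h" for j by (simp add: p_def h_def grid_point_Suc)
  have p_mono: "i \<le> j \<Longrightarrow> p i \<le> p j" for i j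
    unfolding p_def using T_pos by (intro grid_point_mono) auto
  have rq: "r \<omega> \<le> q \<omega>" "q \<omega> \<le> Suc n" if "\<omega> \<in> space M" for \<omega>
    unfolding r_def q_def using range[OF that] T_pos by (auto intro: grid_index_mono grid_index_le)
  interpret filt: filtration "space M" F by (rule filtration_natural_filtration)
  \<comment> \<open>Thanks to rounding up, \<open>r \<omega> \<le> j\<close> means
    \<open>\<sigma> \<omega> \<le> p j\<close> and \<open>j < q \<omega>\<close> means
    \<open>p j < \<tau> \<omega>\<close>, both decided at time \<open>p j\<close>.\<close>
  define I where "I j \<omega> = (if r \<omega> \<le> j \<and> j < q \<omega> then 1 else 0 :: real)" for j \<omega>
  define Y where "Y j \<omega> = x (p j) \<omega> - x (p (r \<omega>)) \<omega>" for j \<omega>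
  define Z where "Z j \<omega> = x (p (Suc j)) \<omega> - x (p j) \<omega>" for j \<omega>
  have meas: "(\<lambda>\<omega>. I j \<omega> * Y j \<omega> ^ k) \<in> borel_measurable (F (p j))" if j: "j < Suc n" for j k
  proof -
    let ?N = "F (p j)"
    have "Measurable.pred ?N (\<lambda>\<omega>. \<sigma> \<omega> \<le> p i)" if "i \<le> j" for i
      by (rule filt.stopping_time_le_const[OF \<sigma> p_mono[OF that]])
    then have "{\<omega> \<in> space ?N. \<sigma> \<omega> \<le> p i} \<in> sets ?N" if "i \<le> j" for i
      using that unfolding pred_def by simp
    \<comment> \<open>The reference value at index \<open>r \<omega>\<close> may still lie in the
      future of \<open>p j\<close>. Truncating the index at \<open>j\<close> makes it measurable and
      does not change the product, because \<open>I j\<close> vanishes when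
      \<open>r \<omega> > j\<close>.\<close>
    then have "{\<omega> \<in> space ?N. min (r \<omega>) j \<le> i} \<in> sets ?N" for i
      by (cases "j \<le> i") (auto simp: min_le_iff_disj r_def grid_index_le_iff[OF T_pos] p_def)
    then have "(\<lambda>\<omega>. min (r \<omega>) j) \<in> measurable ?N (count_space UNIV)"
      by (rule nat_measurable_leI)
    then have g: "(\<lambda>\<omega>. min (r \<omega>) j) \<in> measurable ?N (count_space {..j})"
      by (subst measurable_count_space_eq2_countable) (auto simp: measurable_count_space_eq2_countable)
    have xp: "x (p i) \<in> borel_measurable ?N" if "i \<le> j" for i
      using p_in[of i] p_mono[OF that] that j by (intro x_measurable_F) auto
    have xr: "(\<lambda>\<omega>. x (p (min (r \<omega>) j)) \<omega>) \<in> borel_measurable ?N"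
      by (rule measurable_compose_countable'[OF _ g]) (use xp in auto)
    have 1: "Measurable.pred ?N (\<lambda>\<omega>. \<sigma> \<omega> \<le> p j)" "Measurable.pred ?N (\<lambda>\<omega>. p j < \<tau> \<omega>)"
      using stopping_timeD[OF \<sigma>] stopping_timeD2[OF \<tau>] by auto
    have "I j \<omega> * Y j \<omega> ^ k
        = (if \<sigma> \<omega> \<le> p j \<and> p j < \<tau> \<omega> then (x (p j) \<omega> - x (p (min (r \<omega>) j)) \<omega>) ^ k else 0)" for \<omega>
    proof -
      have "r \<omega> \<le> j \<longleftrightarrow> \<sigma> \<omega> \<le> p j" "j < q \<omega> \<longleftrightarrow> p j < \<tau> \<omega>"
        unfolding r_def q_def p_def using grid_index_le_iff[OF T_pos, of n _ j] by (auto simp: not_le[symmetric])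
      then show ?thesis by (simp add: I_def Y_def min_def)
    qed
    then show ?thesis
      using 1 xr xp[of j] by simp
  qed
  have I01: "I j \<omega> \<in> {0, 1}" for j \<omega> by (simp add: I_def)
  have int: "integrable M (\<lambda>\<omega>. I j \<omega> * Y j \<omega> ^ k)" if j: "j < Suc n" "k \<le> 4" for j k
  proof (rule Bochner_Integration.integrable_bound)
    show "integrable M (\<lambda>\<omega>. 1 + W \<omega>)" using W(1) by simp
    show "(\<lambda>\<omega>. I j \<omega> * Y j \<omega> ^ k) \<in> borel_measurable M" by (rule measurable_F_M[OF meas[OF j(1)]])
    show "AE \<omega> in M. norm (I j \<omega> * Y j \<omega> ^ k) \<le> norm (1 + W \<omega>)"
      using W(3) AE_space
    proof eventually_elim
      case (elim \<omega>)
      show ?case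
      proof (cases "r \<omega> \<le> j \<and> j < q \<omega>")
        case True
        then have "Y j \<omega> ^ 4 \<le> W \<omega>"
          using elim(1) p_in[of j] p_in[of "r \<omega>"] rq[OF elim(2)] by (auto simp: Y_def)
        then show ?thesis
          using True abs_power_le_1_plus_power4[OF j(2), of "Y j \<omega>"] W(2)[of \<omega>] by (simp add: I_def)
      qed (auto simp: I_def)
    qed
  qed
  have zero: "integrable M (\<lambda>\<omega>. (I j \<omega> * Y j \<omega> ^ k) * f (Z j \<omega>))"
      "expectation (\<lambda>\<omega>. (I j \<omega> * Y j \<omega> ^ k) * f (Z j \<omega>)) = 0"
    if j: "j < Suc n" "k \<le> 4" and f: "f \<in> borel_measurable borel" "integrable M (\<lambda>\<omega>. f (Z j \<omega>))"
      "expectation (\<lambda>\<omega>. f (Z j \<omega>)) = 0" for j k f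
  proof -
    have st: "0 \<le> p j" "p j < p (Suc j)" "p (Suc j) \<le> T"
      using p_in[of j] p_in[of "Suc j"] j h by (auto simp: p_Suc)
    note * = past_times_increment[OF st meas[OF j(1), of k] int[OF j] f(1) f(2)[unfolded Z_def], folded Z_def]
    show "integrable M (\<lambda>\<omega>. (I j \<omega> * Y j \<omega> ^ k) * f (Z j \<omega>))" by (rule *)
    show "expectation (\<lambda>\<omega>. (I j \<omega> * Y j \<omega> ^ k) * f (Z j \<omega>)) = 0" using * f(3) by simp
  qed
  \<comment> \<open>Summed over \<open>j\<close>, the indicator leaves the cells from
    \<open>r\<close> to \<open>q\<close> and the potentials telescope; at the lower end
    \<open>Y\<close> is 0, which gives the last term of \<open>D\<close>.\<close>
  define E where "E j \<omega> = I j \<omega> * ((Y j \<omega>)\<^sup>2 * h + potential A h (Y (Suc j) \<omega>) (T - p (Suc j))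
      - potential A h (Y j \<omega>) (T - p j))" for j \<omega>
  have E: "has_bochner_integral M (E j) 0" if j: "j < Suc n" for j
  proof -
    have st: "0 \<le> p j" "p j < p (Suc j)" "p (Suc j) \<le> T"
      using p_in[of j] p_in[of "Suc j"] j h by (auto simp: p_Suc)
    have len: "p (Suc j) - p j = h" by (simp add: p_Suc)
    note m = increment_moments[OF st, folded Z_def, unfolded len]
    have i: "integrable M (\<lambda>\<omega>. Z j \<omega> ^ k)" for k
      using increment_moment(1)[OF st, of k] by (simp add: Z_def)
    have "has_bochner_integral M (\<lambda>\<omega>. (I j \<omega> * Y j \<omega> ^ k) * f (Z j \<omega>)) 0"
      if "k \<le> 4" "f \<in> borel_measurable borel" "integrable M (\<lambda>\<omega>. f (Z j \<omega>))"
        "expectation (\<lambda>\<omega>. f (Z j \<omega>)) = 0" for k f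
      using zero[OF j that] by (simp add: has_bochner_integral_iff)
    note H = this
    have a1: "has_bochner_integral M (\<lambda>\<omega>. (I j \<omega> * Y j \<omega> ^ k) * Z j \<omega>) 0" if "k \<le> 4" for k
      using H[OF that, of "\<lambda>z. z"] i[of 1] m(1) by simp
    have a2: "has_bochner_integral M (\<lambda>\<omega>. (I j \<omega> * Y j \<omega> ^ k) * ((Z j \<omega>)\<^sup>2 - h)) 0" if "k \<le> 4" for k
      using H[OF that, of "\<lambda>z. z\<^sup>2 - h"] i[of 2] m(2) by (simp add: prob_space)
    have a3: "has_bochner_integral M (\<lambda>\<omega>. (I j \<omega> * Y j \<omega> ^ k) * (Z j \<omega>) ^ 3) 0" if "k \<le> 4" for k
      using H[OF that, of "\<lambda>z. z ^ 3"] i[of 3] m(3) by simp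
    have a4: "has_bochner_integral M (\<lambda>\<omega>. (I j \<omega> * Y j \<omega> ^ k) * ((Z j \<omega>) ^ 4 - 3 * h\<^sup>2)) 0" if "k \<le> 4" for k
      using H[OF that, of "\<lambda>z. z ^ 4 - 3 * h\<^sup>2"] i[of 4] m(4) by (simp add: prob_space)
    let ?d = "T - p j"
    \<comment> \<open>This is \<open>potential_step\<close> multiplied by the indicator. The powers
      \<open>^ 1\<close> and \<open>^ 0\<close> stay unsimplified so that every summand has the
      shape of \<open>a1\<close> to \<open>a4\<close>.\<close>
    let ?R = "\<lambda>\<omega>. (2 - 12 * A) * (?d - h) * ((I j \<omega> * Y j \<omega> ^ 1) * Z j \<omega>)
      + (1 - 6 * A) * (?d - h) * ((I j \<omega> * Y j \<omega> ^ 0) * ((Z j \<omega>)\<^sup>2 - h))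
      - 4 * A * ((I j \<omega> * Y j \<omega> ^ 3) * Z j \<omega>) - 6 * A * ((I j \<omega> * Y j \<omega> ^ 2) * ((Z j \<omega>)\<^sup>2 - h))
      - 4 * A * ((I j \<omega> * Y j \<omega> ^ 1) * Z j \<omega> ^ 3) - A * ((I j \<omega> * Y j \<omega> ^ 0) * (Z j \<omega> ^ 4 - 3 * h\<^sup>2))"
    have "has_bochner_integral M ?R
      ((2 - 12 * A) * (?d - h) * 0 + (1 - 6 * A) * (?d - h) * 0 - 4 * A * 0 - 6 * A * 0 - 4 * A * 0 - A * 0)"
      by (intro has_bochner_integral_diff has_bochner_integral_add has_bochner_integral_mult_right a1 a2 a3 a4) auto
    then have "has_bochner_integral M ?R 0"
      by (simp only: mult_zero_right diff_0_right add_0_right)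
    moreover have "E j = ?R"
    proof
      fix \<omega>
      have step: "Y (Suc j) \<omega> = Y j \<omega> + Z j \<omega>" "T - p (Suc j) = ?d - h" by (simp_all add: Y_def Z_def p_Suc)
      show "E j \<omega> = ?R \<omega>" unfolding E_def step potential_step by (simp add: algebra_simps)
    qed
    ultimately show ?thesis by (simp only:)
  qed
  have sumE: "has_bochner_integral M (\<lambda>\<omega>. \<Sum>j<Suc n. E j \<omega>) 0"
    using has_bochner_integral_sum[of "{..<Suc n}" M E "\<lambda>_. 0"] E by auto
  have eq: "D \<omega> = (\<Sum>j<Suc n. E j \<omega>)" if \<omega>: "\<omega> \<in> space M" for \<omega>
  proof -
    have "(\<Sum>j<Suc n. E j \<omega>) = (\<Sum>j\<in>{r \<omega>..<q \<omega>}. (Y j \<omega>)\<^sup>2 * h + potential A h (Y (Suc j) \<omega>) (T - p (Suc j))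
      - potential A h (Y j \<omega>) (T - p j))"
      using rq[OF \<omega>] by (intro sum.mono_neutral_cong_right) (auto simp: E_def I_def)
    also have "\<dots> = (\<Sum>j\<in>{r \<omega>..<q \<omega>}. (Y j \<omega>)\<^sup>2 * h) + (\<Sum>j\<in>{r \<omega>..<q \<omega>}. potential A h (Y (Suc j) \<omega>) (T - p (Suc j))
      - potential A h (Y j \<omega>) (T - p j))"
      by (simp add: sum.distrib sum_subtractf)
    also have "\<dots> = D \<omega>"
      using sum_Suc_diff'[OF rq(1)[OF \<omega>], of "\<lambda>j. potential A h (Y j \<omega>) (T - p j)"]
      by (simp add: D_def Y_def)
    finally show ?thesis by simp
  qed
  have "has_bochner_integral M D 0"
    using sumE by (subst has_bochner_integral_cong[OF refl eq refl])
  then show "integrable M D" "expectation D = 0" by (auto simp: has_bochner_integral_iff)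
qed

end

section \<open>From the grid to continuous time by dominated convergence\<close>

lemma abs_potential_le:
  assumes d: "0 \<le> d" "d \<le> T" and h: "0 \<le> h" "h \<le> T"
  shows "\<bar>potential A h y d\<bar> \<le> (T + T\<^sup>2 + \<bar>A\<bar> * (1 + 6 * T + 3 * T\<^sup>2)) * (1 + y ^ 4)"
proof -
  have T: "0 \<le> T" using d by simp
  have y2: "y\<^sup>2 \<le> 1 + y ^ 4" using abs_power_le_1_plus_power4[of 2 y] by simp
  have y1: "1 \<le> 1 + y ^ 4" by simp
  have y2d: "y\<^sup>2 * d \<le> T * (1 + y ^ 4)"
    using mult_mono[OF y2 d(2)] d y1 by (simp add: mult.commute)
  have d2: "d\<^sup>2 \<le> T\<^sup>2" using d by (intro power_mono)
  have T2: "T\<^sup>2 \<le> T\<^sup>2 * (1 + y ^ 4)" using mult_left_mono[OF y1, of "T\<^sup>2"] by simp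
  have "\<bar>d * (d - h)\<bar> \<le> T * T" unfolding abs_mult using d h by (intro mult_mono) auto
  then have a: "\<bar>d * (d - h) / 2\<bar> \<le> T\<^sup>2 * (1 + y ^ 4)" using T2 by (simp add: power2_eq_square)
  have b: "0 \<le> y ^ 4 + 6 * y\<^sup>2 * d + 3 * d\<^sup>2" using d by simp
  have "y ^ 4 + 6 * y\<^sup>2 * d + 3 * d\<^sup>2 \<le> (1 + y ^ 4) + 6 * (T * (1 + y ^ 4)) + 3 * (T\<^sup>2 * (1 + y ^ 4))"
    using y2d d2 T2 by simp
  also have "\<dots> = (1 + 6 * T + 3 * T\<^sup>2) * (1 + y ^ 4)" by (simp add: algebra_simps)
  finally have "\<bar>A * (y ^ 4 + 6 * y\<^sup>2 * d + 3 * d\<^sup>2)\<bar> \<le> \<bar>A\<bar> * ((1 + 6 * T + 3 * T\<^sup>2) * (1 + y ^ 4))"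
    unfolding abs_mult using b by (intro mult_left_mono) auto
  moreover have "0 \<le> y\<^sup>2 * d" using d by simp
  ultimately have "\<bar>potential A h y d\<bar>
      \<le> T * (1 + y ^ 4) + T\<^sup>2 * (1 + y ^ 4) + \<bar>A\<bar> * ((1 + 6 * T + 3 * T\<^sup>2) * (1 + y ^ 4))"
    unfolding potential_def using y2d a by linarith
  then show ?thesis by (simp add: algebra_simps)
qed

lemma potential_tendsto:
  assumes "h \<longlonglongrightarrow> h'" "y \<longlonglongrightarrow> y'" "d \<longlonglongrightarrow> d'"
  shows "(\<lambda>n. potential A (h n) (y n) (d n)) \<longlonglongrightarrow> potential A h' y' d'"
  unfolding potential_def by (intro tendsto_intros assms) auto

lemma potential_measurable:
  assumes "y \<in> borel_measurable N" "d \<in> borel_measurable N"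
  shows "(\<lambda>\<omega>. potential A h (y \<omega>) (d \<omega>)) \<in> borel_measurable N"
  unfolding potential_def using assms by measurable

context brownian_motion_pos
begin

lemma stopping_time_measurable: "stopping_time F \<sigma> \<Longrightarrow> \<sigma> \<in> borel_measurable M"
  by (rule measurable_stopping_time[of F]) (auto simp: space_F intro: sets_F_subset[THEN subsetD])

text \<open>Along grids of vanishing mesh, \<open>D n\<close> has mean 0, converges on every path to
  \<open>L\<close>, and is dominated by a multiple of \<open>1 + W\<close>. Hence \<open>L\<close>
  is integrable with mean 0, and the integrability of the running cost \<open>C\<close> follows by
  solving the definition of \<open>L\<close> for \<open>C\<close>.\<close>

lemma optional_stopping:
  fixes A :: real
  assumes \<sigma>: "stopping_time F \<sigma>" and \<tau>: "stopping_time F \<tau>"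
    and range: "\<And>\<omega>. \<omega> \<in> space M \<Longrightarrow> 0 \<le> \<sigma> \<omega> \<and> \<sigma> \<omega> \<le> \<tau> \<omega> \<and> \<tau> \<omega> \<le> T"
  defines "C \<equiv> \<lambda>\<omega>. integral {\<sigma> \<omega>..\<tau> \<omega>} (\<lambda>s. (x s \<omega> - x (\<sigma> \<omega>) \<omega>)\<^sup>2)"
    and "Y \<equiv> \<lambda>\<omega>. x (\<tau> \<omega>) \<omega> - x (\<sigma> \<omega>) \<omega>"
  shows "integrable M C" and "integrable M (\<lambda>\<omega>. potential A 0 (Y \<omega>) (T - \<tau> \<omega>))"
    and "integrable M (\<lambda>\<omega>. potential A 0 0 (T - \<sigma> \<omega>))"
    and "expectation C + expectation (\<lambda>\<omega>. potential A 0 (Y \<omega>) (T - \<tau> \<omega>))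
      = expectation (\<lambda>\<omega>. potential A 0 0 (T - \<sigma> \<omega>))"
proof -
  obtain W where W: "integrable M W" "\<And>\<omega>. 0 \<le> W \<omega>"
    "AE \<omega> in M. \<forall>s\<in>{0..T}. \<forall>t\<in>{0..T}. (x t \<omega> - x s \<omega>) ^ 4 \<le> W \<omega>"
    using fourth_moment_dominated by blast
  have [measurable]: "\<sigma> \<in> borel_measurable M" "\<tau> \<in> borel_measurable M"
    using \<sigma> \<tau> by (auto intro: stopping_time_measurable)
  have x_at: "(\<lambda>\<omega>. x (\<rho> \<omega>) \<omega>) \<in> borel_measurable M"
    if "\<rho> \<in> borel_measurable M" "\<And>\<omega>. \<omega> \<in> space M \<Longrightarrow> \<rho> \<omega> \<in> {0..T}" for \<rho>
    by (rule measurable_x_at_random_time[OF that T_pos]) (simp_all add: measurable_x)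
  have [measurable]: "(\<lambda>\<omega>. x (\<sigma> \<omega>) \<omega>) \<in> borel_measurable M" "(\<lambda>\<omega>. x (\<tau> \<omega>) \<omega>) \<in> borel_measurable M"
    by (rule x_at; use range in force)+
  have Y_meas [measurable]: "Y \<in> borel_measurable M" unfolding Y_def by measurable
  define K where "K = T + T\<^sup>2 + \<bar>A\<bar> * (1 + 6 * T + 3 * T\<^sup>2)"
  have K: "0 \<le> K" using T_pos by (simp add: K_def)
  have pot_le: "\<bar>potential A h y d\<bar> \<le> K * (1 + w)"
    if "0 \<le> d" "d \<le> T" "0 \<le> h" "h \<le> T" "y ^ 4 \<le> w" for h y d w
    using abs_potential_le[OF that(1-4), of A y] mult_left_mono[of "1 + y ^ 4" "1 + w" K] that(5) K
    by (simp add: K_def)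
  have int_dom: "integrable M (\<lambda>\<omega>. k * (1 + W \<omega>))" for k using W(1) by simp
  show int_\<tau>: "integrable M (\<lambda>\<omega>. potential A 0 (Y \<omega>) (T - \<tau> \<omega>))"
  proof (rule Bochner_Integration.integrable_bound[OF int_dom[of K]])
    show "(\<lambda>\<omega>. potential A 0 (Y \<omega>) (T - \<tau> \<omega>)) \<in> borel_measurable M"
      by (rule potential_measurable) measurable
    show "AE \<omega> in M. norm (potential A 0 (Y \<omega>) (T - \<tau> \<omega>)) \<le> norm (K * (1 + W \<omega>))"
      using W(3) AE_space
    proof eventually_elim
      case (elim \<omega>)
      then have "Y \<omega> ^ 4 \<le> W \<omega>" using range[of \<omega>] by (auto simp: Y_def)
      then show ?case
        using pot_le[of "T - \<tau> \<omega>" 0 "Y \<omega>" "W \<omega>"] range[OF elim(2)] T_pos by simp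
    qed
  qed
  show int_\<sigma>: "integrable M (\<lambda>\<omega>. potential A 0 0 (T - \<sigma> \<omega>))"
  proof (rule integrable_const_bound[of _ K])
    show "(\<lambda>\<omega>. potential A 0 0 (T - \<sigma> \<omega>)) \<in> borel_measurable M"
      by (rule potential_measurable) measurable
    show "AE \<omega> in M. norm (potential A 0 0 (T - \<sigma> \<omega>)) \<le> K"
      using AE_space
    proof eventually_elim
      case (elim \<omega>)
      then show ?case using pot_le[of "T - \<sigma> \<omega>" 0 0 0] range[OF elim] T_pos by simp
    qed
  qed
  define p where "p = grid_point T"
  define h where "h n = T / real (Suc n)" for n
  define r where "r n \<omega> = grid_index T n (\<sigma> \<omega>)" for n \<omega>
  define q where "q n \<omega> = grid_index T n (\<tau> \<omega>)" for n \<omega>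
  define S where "S n \<omega> = (\<Sum>j\<in>{r n \<omega>..<q n \<omega>}. (x (p n j) \<omega> - x (p n (r n \<omega>)) \<omega>)\<^sup>2 * h n)" for n \<omega>
  define D where "D n \<omega> = S n \<omega> + potential A (h n) (x (p n (q n \<omega>)) \<omega> - x (p n (r n \<omega>)) \<omega>) (T - p n (q n \<omega>))
      - potential A (h n) 0 (T - p n (r n \<omega>))" for n \<omega>
  define L where "L \<omega> = C \<omega> + potential A 0 (Y \<omega>) (T - \<tau> \<omega>) - potential A 0 0 (T - \<sigma> \<omega>)" for \<omega>
  have D: "integrable M (D n)" "expectation (D n) = 0" for n
    using grid_optional_stopping[OF \<sigma> \<tau> range, of n A]
    unfolding D_def S_def p_def h_def r_def q_def by auto
  have h: "0 \<le> h n" "h n \<le> T" "real (Suc n) * h n = T" for n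
    using T_pos by (auto simp: h_def pos_divide_le_eq)
  have idx: "p n (r n \<omega>) \<in> {0..T}" "p n (q n \<omega>) \<in> {0..T}" "q n \<omega> \<le> Suc n" if "\<omega> \<in> space M" for n \<omega>
    using range[OF that] T_pos unfolding p_def r_def q_def
    by (auto intro!: grid_point_index_in grid_index_le simp del: atLeastAtMost_iff) auto
  have lim: "(\<lambda>n. D n \<omega>) \<longlonglongrightarrow> L \<omega>" if \<omega>: "\<omega> \<in> space M" for \<omega>
  proof -
    note cont = continuous_paths[OF \<omega>]
    have rng: "\<sigma> \<omega> \<in> {0..T}" "\<tau> \<omega> \<in> {0..T}" "\<sigma> \<omega> \<le> \<tau> \<omega>" using range[OF \<omega>] by auto
    have S: "(\<lambda>n. S n \<omega>) \<longlonglongrightarrow> C \<omega>"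
      unfolding S_def C_def p_def h_def r_def q_def
      by (rule grid_sum_tendsto_integral[OF T_pos cont]) (use rng in auto)
    have pr: "(\<lambda>n. p n (r n \<omega>)) \<longlonglongrightarrow> \<sigma> \<omega>" and pq: "(\<lambda>n. p n (q n \<omega>)) \<longlonglongrightarrow> \<tau> \<omega>"
      unfolding p_def r_def q_def using rng T_pos by (auto intro: grid_point_index_tendsto)
    have xr: "(\<lambda>n. x (p n (r n \<omega>)) \<omega>) \<longlonglongrightarrow> x (\<sigma> \<omega>) \<omega>"
      using continuous_on_tendsto_compose[OF cont pr rng(1)] idx[OF \<omega>] by auto
    have xq: "(\<lambda>n. x (p n (q n \<omega>)) \<omega>) \<longlonglongrightarrow> x (\<tau> \<omega>) \<omega>"
      using continuous_on_tendsto_compose[OF cont pq rng(2)] idx[OF \<omega>] by auto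
    have h0: "h \<longlonglongrightarrow> 0" unfolding h_def[abs_def] by (rule mesh_tendsto_0)
    show ?thesis
      unfolding D_def L_def Y_def
      by (intro tendsto_diff tendsto_add S potential_tendsto h0 xr xq pr pq tendsto_const)
  qed
  \<comment> \<open>At most \<open>Suc n\<close> cells of length \<open>h n\<close> cover total
    length \<open>T\<close>, which bounds the Riemann sum by \<open>T * (1 + W \<omega>)\<close>;
    each of the two potentials contributes \<open>K\<close>.\<close>
  have bound: "AE \<omega> in M. norm (D n \<omega>) \<le> (T + 2 * K) * (1 + W \<omega>)" for n
    using W(3) AE_space
  proof eventually_elim
    case (elim \<omega>)
    note idx = idx[OF elim(2), of n]
    have y4: "(x (p n j) \<omega> - x (p n (r n \<omega>)) \<omega>) ^ 4 \<le> W \<omega>" if "j \<le> Suc n" for j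
      using elim(1) idx(1) grid_point_in[of T j n] that T_pos unfolding p_def by auto
    have term_le: "(x (p n j) \<omega> - x (p n (r n \<omega>)) \<omega>)\<^sup>2 * h n \<le> (1 + W \<omega>) * h n"
      if "j \<in> {r n \<omega>..<q n \<omega>}" for j
      using y4[of j] abs_power_le_1_plus_power4[of 2 "x (p n j) \<omega> - x (p n (r n \<omega>)) \<omega>"] h(1)[of n] that idx(3)
      by (intro mult_right_mono) auto
    have "S n \<omega> \<le> real (card {r n \<omega>..<q n \<omega>}) * ((1 + W \<omega>) * h n)"
      unfolding S_def by (rule sum_bounded_above) (rule term_le)
    also have "\<dots> \<le> real (Suc n) * ((1 + W \<omega>) * h n)"
      using idx(3) h(1)[of n] W(2)[of \<omega>] by (intro mult_right_mono) auto
    also have "\<dots> = T * (1 + W \<omega>)" using h(3)[of n] by (simp add: mult.left_commute mult.commute del: of_nat_Suc)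
    finally have S: "S n \<omega> \<le> T * (1 + W \<omega>)" .
    have S0: "0 \<le> S n \<omega>" unfolding S_def using h(1) by (intro sum_nonneg) auto
    have 1: "\<bar>potential A (h n) (x (p n (q n \<omega>)) \<omega> - x (p n (r n \<omega>)) \<omega>) (T - p n (q n \<omega>))\<bar> \<le> K * (1 + W \<omega>)"
      using idx h[of n] y4[OF idx(3)] by (intro pot_le) auto
    have 2: "\<bar>potential A (h n) 0 (T - p n (r n \<omega>))\<bar> \<le> K * (1 + W \<omega>)"
      using idx h[of n] W(2)[of \<omega>] by (intro pot_le) auto
    have "(T + 2 * K) * (1 + W \<omega>) = T * (1 + W \<omega>) + K * (1 + W \<omega>) + K * (1 + W \<omega>)"
      by (simp add: algebra_simps)
    then show ?case using S S0 1 2 unfolding D_def real_norm_def by linarith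
  qed
  have L_meas: "L \<in> borel_measurable M"
    by (rule borel_measurable_LIMSEQ_real[OF lim]) (use D(1) in auto)
  note dct = L_meas borel_measurable_integrable[OF D(1)] int_dom AE_I2[OF lim] bound
  have L: "integrable M L" by (rule integrable_dominated_convergence[OF dct])
  have "(\<lambda>n. expectation (D n)) \<longlonglongrightarrow> expectation L"
    by (rule integral_dominated_convergence[OF dct])
  then have EL: "expectation L = 0" using D(2) by (simp add: LIMSEQ_const_iff)
  have C_eq: "C = (\<lambda>\<omega>. L \<omega> - potential A 0 (Y \<omega>) (T - \<tau> \<omega>) + potential A 0 0 (T - \<sigma> \<omega>))"
    by (simp add: L_def)
  show "integrable M C" unfolding C_eq using L int_\<tau> int_\<sigma> by simp
  show "expectation C + expectation (\<lambda>\<omega>. potential A 0 (Y \<omega>) (T - \<tau> \<omega>))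
      = expectation (\<lambda>\<omega>. potential A 0 0 (T - \<sigma> \<omega>))"
    unfolding C_eq using L int_\<tau> int_\<sigma> EL by simp
qed

text \<open>The two equations for \<open>A\<close> and \<open>g\<close> say precisely that the
  potential at time \<open>\<tau>\<close> is the continuation term \<open>\<theta> * d^2 / 2\<close>
  minus \<open>A\<close> times a perfect square. At time \<open>\<sigma>\<close> the error is 0, and
  only the \<open>d^2\<close> term survives, with coefficient
  \<open>(1 - 6 * A) / 2\<close>.\<close>

lemma stage_cost:
  fixes A g \<theta> :: real
  assumes \<sigma>: "stopping_time F \<sigma>" and \<tau>: "stopping_time F \<tau>"
    and range: "\<And>\<omega>. \<omega> \<in> space M \<Longrightarrow> 0 \<le> \<sigma> \<omega> \<and> \<sigma> \<omega> \<le> \<tau> \<omega> \<and> \<tau> \<omega> \<le> T"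
    and A: "A * (2 * g + 6) = 1" "A * g\<^sup>2 = 3 * A - (1 - \<theta>) / 2"
  shows "expectation (\<lambda>\<omega>. integral {\<sigma> \<omega>..\<tau> \<omega>} (\<lambda>s. (x s \<omega> - x (\<sigma> \<omega>) \<omega>)\<^sup>2))
      = (1 - 6 * A) * expectation (\<lambda>\<omega>. (T - \<sigma> \<omega>)\<^sup>2 / 2) - \<theta> * expectation (\<lambda>\<omega>. (T - \<tau> \<omega>)\<^sup>2 / 2)
        + A * expectation (\<lambda>\<omega>. ((x (\<tau> \<omega>) \<omega> - x (\<sigma> \<omega>) \<omega>)\<^sup>2 - g * (T - \<tau> \<omega>))\<^sup>2)"
proof -
  let ?y = "\<lambda>\<omega>. x (\<tau> \<omega>) \<omega> - x (\<sigma> \<omega>) \<omega>"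
  let ?sq = "\<lambda>\<omega>. ((?y \<omega>)\<^sup>2 - g * (T - \<tau> \<omega>))\<^sup>2"
  note os = optional_stopping(2-4)[OF \<sigma> \<tau> range, where A = A]
  have pot_eq: "potential A 0 y d = \<theta> * (d\<^sup>2 / 2) - A * (y\<^sup>2 - g * d)\<^sup>2" for y d
  proof -
    have "A * (y\<^sup>2 - g * d)\<^sup>2 = A * y ^ 4 - (A * (2 * g + 6)) * (y\<^sup>2 * d) + 6 * A * (y\<^sup>2 * d) + (A * g\<^sup>2) * d\<^sup>2"
      by (simp add: power2_eq_square power4_eq_xxxx algebra_simps)
    also have "\<dots> = A * y ^ 4 - y\<^sup>2 * d + 6 * A * (y\<^sup>2 * d) + (3 * A - (1 - \<theta>) / 2) * d\<^sup>2"
      unfolding A by simp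
    finally show ?thesis by (simp add: potential_def power2_eq_square field_simps)
  qed
  have "A \<noteq> 0" using A(1) by auto
  have sq_int: "integrable M (\<lambda>\<omega>. (T - \<rho> \<omega>)\<^sup>2 / 2)"
    if "stopping_time F \<rho>" "\<And>\<omega>. \<omega> \<in> space M \<Longrightarrow> 0 \<le> \<rho> \<omega> \<and> \<rho> \<omega> \<le> T" for \<rho>
  proof (rule integrable_const_bound[of _ "T\<^sup>2"])
    have [measurable]: "\<rho> \<in> borel_measurable M" using that(1) by (rule stopping_time_measurable)
    show "(\<lambda>\<omega>. (T - \<rho> \<omega>)\<^sup>2 / 2) \<in> borel_measurable M" by measurable
    show "AE \<omega> in M. norm ((T - \<rho> \<omega>)\<^sup>2 / 2) \<le> T\<^sup>2"
      using AE_space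
    proof eventually_elim
      case (elim \<omega>)
      then have "(T - \<rho> \<omega>)\<^sup>2 \<le> T\<^sup>2" using that(2)[OF elim] by (intro power_mono) auto
      then show ?case
        using zero_le_power2[of T] zero_le_power2[of "T - \<rho> \<omega>"] unfolding real_norm_def by linarith
    qed
  qed
  have i\<tau>: "integrable M (\<lambda>\<omega>. (T - \<tau> \<omega>)\<^sup>2 / 2)" using range by (intro sq_int \<tau>) force
  have "integrable M (\<lambda>\<omega>. \<theta> * ((T - \<tau> \<omega>)\<^sup>2 / 2) - (\<theta> * ((T - \<tau> \<omega>)\<^sup>2 / 2) - A * ?sq \<omega>))"
    by (rule Bochner_Integration.integrable_diff[OF integrable_mult_right[OF i\<tau>] os(1)[unfolded pot_eq]])
  then have "integrable M (\<lambda>\<omega>. A * ?sq \<omega>)"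
    by (simp only: diff_diff_eq2 add_diff_cancel_left')
  then have "integrable M (\<lambda>\<omega>. 1 / A * (A * ?sq \<omega>))" by (rule integrable_mult_right)
  then have isq: "integrable M ?sq" using \<open>A \<noteq> 0\<close> by simp
  have "expectation (\<lambda>\<omega>. potential A 0 (?y \<omega>) (T - \<tau> \<omega>))
      = \<theta> * expectation (\<lambda>\<omega>. (T - \<tau> \<omega>)\<^sup>2 / 2) - A * expectation ?sq"
    unfolding pot_eq using i\<tau> isq by (simp del: integral_divide_zero integral_divide times_divide_eq_right)
  moreover have "expectation (\<lambda>\<omega>. potential A 0 0 (T - \<sigma> \<omega>)) = (1 - 6 * A) * expectation (\<lambda>\<omega>. (T - \<sigma> \<omega>)\<^sup>2 / 2)"
  proof -
    have "potential A 0 0 d = (1 - 6 * A) * (d\<^sup>2 / 2)" for d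
      by (simp add: potential_def power2_eq_square field_simps)
    then show ?thesis by (simp del: integral_divide_zero integral_divide times_divide_eq_right)
  qed
  ultimately show ?thesis using os(3) by simp
qed

text \<open>With \<open>A = 0\<close> only the running-cost martingale remains, and its potential
  \<open>y^2 d + d^2 / 2\<close> vanishes at the horizon, where \<open>d = 0\<close>.\<close>

lemma last_stage_cost:
  assumes \<sigma>: "stopping_time F \<sigma>" and range: "\<And>\<omega>. \<omega> \<in> space M \<Longrightarrow> 0 \<le> \<sigma> \<omega> \<and> \<sigma> \<omega> \<le> T"
  shows "expectation (\<lambda>\<omega>. integral {\<sigma> \<omega>..T} (\<lambda>s. (x s \<omega> - x (\<sigma> \<omega>) \<omega>)\<^sup>2))
      = expectation (\<lambda>\<omega>. (T - \<sigma> \<omega>)\<^sup>2 / 2)"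
  using optional_stopping(4)[OF \<sigma> stopping_time_const[of _ T], where A = 0] range
  by (simp add: potential_def power2_eq_square)

end

subsection \<open>The threshold policy\<close>

text \<open>For \<open>b = 5 + theta k\<close> and \<open>s = sqrt (b^2 - 24)\<close>, the
  inequality \<open>b \<ge> 5\<close> gives \<open>(b - 4)^2 \<le> s^2 < b^2\<close>. Thus
  \<open>(b - s) / 4\<close>, the smaller root of the quadratic, lies in the interval from 0
  (excluded) to 1.\<close>

lemma theta_bounds: "0 \<le> theta k" "theta k \<le> 1"
  and theta_quadratic: "2 * (1 - theta (Suc k))\<^sup>2 - (5 + theta k) * (1 - theta (Suc k)) + 3 = 0"
  and theta_Suc_less: "theta (Suc k) < 1"
proof -
  have step: "0 \<le> theta (Suc k) \<and> theta (Suc k) < 1 \<and>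
      2 * (1 - theta (Suc k))\<^sup>2 - (5 + theta k) * (1 - theta (Suc k)) + 3 = 0" if "0 \<le> theta k" for k
  proof -
    define b where "b = 5 + theta k"
    define s where "s = sqrt (b\<^sup>2 - 24)"
    have b: "5 \<le> b" using that by (simp add: b_def)
    have disc: "(b - 4)\<^sup>2 \<le> b\<^sup>2 - 24" using b by (simp add: power2_eq_square algebra_simps)
    then have s2: "s\<^sup>2 = b\<^sup>2 - 24" unfolding s_def
      by (intro real_sqrt_pow2) (use zero_le_power2[of "b - 4"] in linarith)
    have "b - 4 \<le> s" unfolding s_def using disc by (rule real_le_rsqrt)
    moreover have "s < b" using s2 b by (intro power2_less_imp_less[of s b]) auto
    moreover have th: "theta (Suc k) = 1 - (b - s) / 4" by (simp add: b_def s_def)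
    moreover have "2 * (1 - theta (Suc k))\<^sup>2 - b * (1 - theta (Suc k)) + 3 = 0"
      using s2 unfolding th by (simp add: power2_eq_square field_simps)
    ultimately show ?thesis by (simp add: b_def)
  qed
  have "0 \<le> theta k \<and> theta k \<le> 1" for k
    by (induction k) (use step in \<open>auto simp del: theta.simps(2) intro: less_imp_le\<close>)
  then show "0 \<le> theta k" "theta k \<le> 1" by auto
  then show "2 * (1 - theta (Suc k))\<^sup>2 - (5 + theta k) * (1 - theta (Suc k)) + 3 = 0"
    "theta (Suc k) < 1" using step by blast+
qed

text \<open>With \<open>a = 1 - theta (Suc k)\<close> the quadratic reads
  \<open>3 * (1 - a)^2 = (theta k - (1 - a)) * a\<close>. Multiplied by 3 and divided by
  \<open>a^2\<close>, it shows that the radicand in \<open>gamma\<close> is the square of a rational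
  expression.\<close>

lemma theta_Suc_ratio:
  "(3 * theta (Suc k) / (1 - theta (Suc k)))\<^sup>2 = 3 * (theta k - theta (Suc k)) / (1 - theta (Suc k))"
proof -
  define a where "a = 1 - theta (Suc k)"
  have a: "0 < a" using theta_Suc_less[of k] by (simp add: a_def)
  have th: "theta (Suc k) = 1 - a" by (simp add: a_def)
  have "3 * (1 - a)\<^sup>2 = (theta k - (1 - a)) * a"
    using theta_quadratic[of k] unfolding a_def[symmetric] by (simp add: power2_eq_square algebra_simps)
  moreover have "(3 * (1 - a))\<^sup>2 = 3 * (3 * (1 - a)\<^sup>2)" by (simp add: power2_eq_square algebra_simps)
  ultimately have "(3 * (1 - a))\<^sup>2 / a\<^sup>2 = 3 * ((theta k - (1 - a)) * a) / a\<^sup>2" by simp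
  then show ?thesis using a unfolding th by (simp add: power_divide power2_eq_square)
qed

lemma gamma_Suc: "gamma (Suc k) = 3 * theta (Suc k) / (1 - theta (Suc k))"
proof -
  have "0 \<le> 3 * theta (Suc k) / (1 - theta (Suc k))"
    using theta_bounds(1)[of "Suc k"] theta_Suc_less[of k] by (simp del: theta.simps)
  then show ?thesis unfolding gamma_def using theta_Suc_ratio[of k] by (metis diff_Suc_1 real_sqrt_unique)
qed

lemma gamma_nonneg: "0 < k \<Longrightarrow> 0 \<le> gamma k"
  using gamma_Suc[of "k - 1"] theta_bounds[of k] by (simp del: theta.simps)

text \<open>These are the hypotheses of \<open>stage_cost\<close> for the slope
  \<open>gamma (Suc k)\<close> and the continuation coefficient \<open>theta k\<close>.\<close>

lemma theta_gamma_equations: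
  fixes k defines "A \<equiv> (1 - theta (Suc k)) / 6"
  shows "A * (2 * gamma (Suc k) + 6) = 1" "A * (gamma (Suc k))\<^sup>2 = 3 * A - (1 - theta k) / 2"
proof -
  have a: "0 < 1 - theta (Suc k)" using theta_Suc_less[of k] by simp
  show "A * (2 * gamma (Suc k) + 6) = 1"
    using a unfolding A_def gamma_Suc by (simp add: field_simps del: theta.simps)
  have "(gamma (Suc k))\<^sup>2 = 3 * (theta k - theta (Suc k)) / (1 - theta (Suc k))"
    using theta_Suc_ratio[of k] unfolding gamma_Suc .
  then show "A * (gamma (Suc k))\<^sup>2 = 3 * A - (1 - theta k) / 2"
    using a unfolding A_def by (simp add: field_simps del: theta.simps)
qed

text \<open>The set is closed and contains \<open>T\<close>, so its infimum is attained. The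
  threshold is met with equality because the difference is at most 0 at the start \<open>s\<close>:
  a strict overshoot at \<open>H\<close> would force an earlier zero by the intermediate value
  theorem.\<close>

lemma first_hitting_time:
  fixes f :: "real \<Rightarrow> real"
  assumes cont: "continuous_on {s..T} f" and s: "s \<le> T" and g: "0 \<le> g"
  defines "H \<equiv> Inf {t \<in> {s..T}. (f t - f s)\<^sup>2 \<ge> g * (T - t)}"
  shows "s \<le> H" and "H \<le> T" and "(f H - f s)\<^sup>2 = g * (T - H)"
    and "\<And>t. t \<in> {s..T} \<Longrightarrow> g * (T - t) \<le> (f t - f s)\<^sup>2 \<Longrightarrow> H \<le> t"
proof -
  define \<phi> where "\<phi> t = (f t - f s)\<^sup>2 - g * (T - t)" for t
  have cont\<phi>: "continuous_on {s..T} \<phi>" unfolding \<phi>_def by (intro continuous_intros cont)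
  let ?S = "{s..T} \<inter> \<phi> -` {0..}"
  have S_eq: "{t \<in> {s..T}. (f t - f s)\<^sup>2 \<ge> g * (T - t)} = ?S" by (auto simp: \<phi>_def)
  have "closed ?S" by (rule continuous_closed_preimage[OF cont\<phi>]) auto
  moreover have "T \<in> ?S" using s by (simp add: \<phi>_def)
  moreover have bdd: "bdd_below ?S" by (intro bdd_belowI[of _ s]) auto
  ultimately have HS: "H \<in> ?S" unfolding H_def S_eq by (intro closed_contains_Inf) auto
  then show H: "s \<le> H" "H \<le> T" by auto
  show least: "H \<le> t" if "t \<in> {s..T}" "g * (T - t) \<le> (f t - f s)\<^sup>2" for t
    unfolding H_def S_eq by (rule cInf_lower[OF _ bdd]) (use that in \<open>auto simp: \<phi>_def\<close>)
  have "\<not> 0 < \<phi> H"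
  proof
    assume pos: "0 < \<phi> H"
    have "\<phi> s \<le> 0" using g s by (simp add: \<phi>_def)
    then obtain t where "s \<le> t" "t \<le> H" "\<phi> t = 0"
      using IVT'[of \<phi> s 0 H] pos H continuous_on_subset[OF cont\<phi>, of "{s..H}"] by auto
    moreover from this have "H \<le> t" using H by (intro least) (auto simp: \<phi>_def)
    ultimately show False using pos by auto
  qed
  with HS show "(f H - f s)\<^sup>2 = g * (T - H)" by (auto simp: \<phi>_def)
qed

section \<open>Admissibility of the threshold policy and the exact cost of any policy\<close>

context brownian_motion_pos
begin

text \<open>The filtration is not enlarged, so \<open>H \<omega> \<le> t\<close> has to be decided
  by the path up to \<open>t\<close>. By compactness it means that the continuous difference has
  maximum at least 0 on the interval from \<open>\<sigma> \<omega>\<close> to \<open>t\<close>,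
  which can be tested with slack \<open>1 / Suc m\<close> on a countable set of times.\<close>

lemma hitting_time_stopping_time:
  assumes \<sigma>: "stopping_time F \<sigma>" and range: "\<And>\<omega>. \<omega> \<in> space M \<Longrightarrow> 0 \<le> \<sigma> \<omega> \<and> \<sigma> \<omega> \<le> T"
    and g: "0 \<le> g"
  defines "H \<equiv> \<lambda>\<omega>. Inf {t \<in> {\<sigma> \<omega>..T}. (x t \<omega> - x (\<sigma> \<omega>) \<omega>)\<^sup>2 \<ge> g * (T - t)}"
  shows "stopping_time F H"
proof
  fix t
  have cont: "continuous_on {\<sigma> \<omega>..T} (\<lambda>t. x t \<omega>)" if "\<omega> \<in> space M" for \<omega>
    using continuous_paths[OF that] range[OF that] by (auto intro: continuous_on_subset)
  have hit: "\<sigma> \<omega> \<le> H \<omega>" "H \<omega> \<le> T" "(x (H \<omega>) \<omega> - x (\<sigma> \<omega>) \<omega>)\<^sup>2 = g * (T - H \<omega>)"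
    "\<And>t. t \<in> {\<sigma> \<omega>..T} \<Longrightarrow> g * (T - t) \<le> (x t \<omega> - x (\<sigma> \<omega>) \<omega>)\<^sup>2 \<Longrightarrow> H \<omega> \<le> t"
    if "\<omega> \<in> space M" for \<omega>
    unfolding H_def by (rule first_hitting_time[OF cont[OF that] conjunct2[OF range[OF that]] g]; assumption)+
  consider "t < 0" | "T \<le> t" | "0 \<le> t" "t < T" by linarith
  then show "Measurable.pred (F t) (\<lambda>\<omega>. H \<omega> \<le> t)"
  proof cases
    case 1
    then have "\<not> H \<omega> \<le> t" if "\<omega> \<in> space M" for \<omega> using hit(1)[OF that] range[OF that] by force
    then show ?thesis by (subst measurable_cong[of _ _ "\<lambda>_. False"]) (auto simp: space_F)
  next
    case 2
    then have "H \<omega> \<le> t" if "\<omega> \<in> space M" for \<omega> using hit(2)[OF that] range[OF that] by force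
    then show ?thesis by (subst measurable_cong[of _ _ "\<lambda>_. True"]) (auto simp: space_F)
  next
    case 3
    let ?N = "F t"
    interpret filt: filtration "space M" F by (rule filtration_natural_filtration)
    have \<sigma>_le: "{\<omega> \<in> space ?N. \<sigma> \<omega> \<le> s} \<in> sets ?N" if "s \<le> t" for s
      using filt.stopping_time_le_const[OF \<sigma> that] by (simp add: pred_def)
    \<comment> \<open>Stopping \<open>\<sigma>\<close> at \<open>t\<close> makes the reference value
      \<open>F t\<close>-measurable; it is the true one on \<open>\<sigma> \<omega> \<le> t\<close>,
      the only case in which it is used.\<close>
    define Z where "Z \<omega> = x (min (\<sigma> \<omega>) t) \<omega>" for \<omega>
    have Z: "Z \<in> borel_measurable ?N"
    \<comment> \<open>For \<open>t = 0\<close> the interval \<open>{0..t}\<close> carries no grid,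
      but then \<open>Z\<close> is just the initial value.\<close>
    proof (cases "t = 0")
      case True
      then have "Z \<omega> = x 0 \<omega>" if "\<omega> \<in> space ?N" for \<omega>
        using range[of \<omega>] that by (auto simp: Z_def space_F min_absorb2)
      then show ?thesis using x_measurable_F[of 0 t] 3 T_pos by (subst measurable_cong) auto
    next
      case False
      have min_meas: "(\<lambda>\<omega>. min (\<sigma> \<omega>) t) \<in> borel_measurable ?N"
      proof (rule borel_measurableI_le)
        fix s show "{\<omega> \<in> space ?N. min (\<sigma> \<omega>) t \<le> s} \<in> sets ?N"
          using \<sigma>_le[of s] by (cases "t \<le> s") (auto simp: min_le_iff_disj)
      qed
      show ?thesis
        unfolding Z_def
        by (rule measurable_x_at_random_time[OF min_meas, of t])
          (use False 3 range in \<open>auto simp: space_F intro: x_measurable_F\<close>)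
    qed
    \<comment> \<open>If \<open>H \<omega> < t\<close>, rationals just to the right of
      \<open>H \<omega>\<close> do the approximation and stay above
      \<open>\<sigma> \<omega>\<close>. If \<open>H \<omega> = t\<close>, there is no room to the
      right, so \<open>t\<close> itself must belong to the set.\<close>
    define R where "R = insert t ({0..t} \<inter> \<rat>)"
    have "countable R" unfolding R_def by (simp add: countable_rat)
    have R: "s \<in> R \<Longrightarrow> 0 \<le> s \<and> s \<le> t" for s using 3 by (auto simp: R_def)
    have iff: "H \<omega> \<le> t \<longleftrightarrow> \<sigma> \<omega> \<le> t \<and> (\<forall>m. \<exists>s\<in>R. \<sigma> \<omega> \<le> s \<and> - 1 / real (Suc m) < (x s \<omega> - Z \<omega>)\<^sup>2 - g * (T - s))"
      (is "_ \<longleftrightarrow> _ \<and> ?appr") if \<omega>: "\<omega> \<in> space M" for \<omega>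
    proof -
      note hit = hit[OF \<omega>]
      define \<phi> where "\<phi> s = (x s \<omega> - x (\<sigma> \<omega>) \<omega>)\<^sup>2 - g * (T - s)" for s
      have cont\<phi>: "continuous_on {\<sigma> \<omega>..T} \<phi>"
        unfolding \<phi>_def by (intro continuous_intros cont[OF \<omega>])
      have Z_eq: "Z \<omega> = x (\<sigma> \<omega>) \<omega>" if "\<sigma> \<omega> \<le> t" using that by (simp add: Z_def)
      show ?thesis
      proof
        assume Ht: "H \<omega> \<le> t"
        then have \<sigma>t: "\<sigma> \<omega> \<le> t" using hit(1) by simp
        have \<phi>H: "\<phi> (H \<omega>) = 0" using hit(3) by (simp add: \<phi>_def)
        have "\<exists>s\<in>R. \<sigma> \<omega> \<le> s \<and> - 1 / real (Suc m) < \<phi> s" for m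
        proof (cases "H \<omega> = t")
          case True
          then show ?thesis using \<phi>H \<sigma>t by (intro bexI[of _ t]) (auto simp: R_def)
        next
          case False
          obtain d where d: "0 < d" "\<And>s. s \<in> {\<sigma> \<omega>..T} \<Longrightarrow> \<bar>s - H \<omega>\<bar> < d \<Longrightarrow> \<bar>\<phi> s - \<phi> (H \<omega>)\<bar> < 1 / real (Suc m)"
            using cont\<phi>[unfolded continuous_on_iff dist_real_def, rule_format, of "H \<omega>" "1 / real (Suc m)"]
              hit(1,2) by auto
          obtain s where s: "s \<in> \<rat>" "H \<omega> < s" "s < min (H \<omega> + d) t"
            using Rats_dense_in_real[of "H \<omega>" "min (H \<omega> + d) t"] d(1) False Ht by auto
          have "\<bar>\<phi> s - \<phi> (H \<omega>)\<bar> < 1 / real (Suc m)" using s hit(1) 3 by (intro d(2)) auto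
          then have "- 1 / real (Suc m) < \<phi> s" using \<phi>H by (simp add: abs_less_iff del: of_nat_Suc)
          moreover have "s \<in> R" using s hit(1) range[OF \<omega>] by (auto simp: R_def)
          ultimately show ?thesis using s hit(1) by (intro bexI[of _ s]) auto
        qed
        then show "\<sigma> \<omega> \<le> t \<and> ?appr" using \<sigma>t by (simp add: Z_eq \<phi>_def)
      next
        assume "\<sigma> \<omega> \<le> t \<and> ?appr"
        then have \<sigma>t: "\<sigma> \<omega> \<le> t"
          and appr: "\<And>m. \<exists>s\<in>R. \<sigma> \<omega> \<le> s \<and> - 1 / real (Suc m) < \<phi> s"
          by (auto simp: Z_eq \<phi>_def)
        obtain u where u: "u \<in> {\<sigma> \<omega>..t}" "\<And>s. s \<in> {\<sigma> \<omega>..t} \<Longrightarrow> \<phi> s \<le> \<phi> u"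
          using continuous_attains_sup[of "{\<sigma> \<omega>..t}" \<phi>] continuous_on_subset[OF cont\<phi>, of "{\<sigma> \<omega>..t}"] \<sigma>t 3
          by auto
        have "0 \<le> \<phi> u"
        proof (rule ccontr)
          assume "\<not> 0 \<le> \<phi> u"
          then obtain m where m: "1 / real (Suc m) < - \<phi> u"
            using reals_Archimedean[of "- \<phi> u"] by (auto simp: inverse_eq_divide)
          obtain s where "s \<in> R" "\<sigma> \<omega> \<le> s" "- 1 / real (Suc m) < \<phi> s" using appr by blast
          with u(2)[of s] R[of s] m show False by (auto simp del: of_nat_Suc)
        qed
        then have "H \<omega> \<le> u" using u(1) 3 by (intro hit(4)) (auto simp: \<phi>_def)
        then show "H \<omega> \<le> t" using u(1) by simp
      qed
    qed
    have "{\<omega> \<in> space ?N. \<sigma> \<omega> \<le> t \<and> (\<forall>m. \<exists>s\<in>R. \<sigma> \<omega> \<le> s \<and> - 1 / real (Suc m) < (x s \<omega> - Z \<omega>)\<^sup>2 - g * (T - s))} \<in> sets ?N"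
    proof (intro sets.sets_Collect_conj sets.sets_Collect_countable_All sets.sets_Collect_countable_Ex' \<open>countable R\<close> \<sigma>_le order_refl)
      fix m s assume s: "s \<in> R"
      then show "s \<le> t" using R by auto
      have "x s \<in> borel_measurable ?N" using R[OF s] 3 by (intro x_measurable_F) auto
      with Z show "{\<omega> \<in> space ?N. - 1 / real (Suc m) < (x s \<omega> - Z \<omega>)\<^sup>2 - g * (T - s)} \<in> sets ?N"
        by measurable
    qed
    then show ?thesis
      unfolding pred_def by (rule back_subst[of "\<lambda>A. A \<in> sets ?N"]) (use iff in \<open>auto simp: space_F simp del: of_nat_Suc\<close>)
  qed
qed

lemma optimal_time_properties:
  assumes "k \<le> N"
  shows "stopping_time F (optimal_time T N x k) \<and> (\<forall>\<omega>\<in>space M. 0 \<le> optimal_time T N x k \<omega> \<and> optimal_time T N x k \<omega> \<le> T)"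
  using assms
proof (induction k)
  case 0
  have "optimal_time T N x 0 = (\<lambda>_. 0)" by (simp add: fun_eq_iff)
  then show ?case using T_pos by (simp add: stopping_time_const)
next
  case (Suc k)
  let ?\<sigma> = "optimal_time T N x k"
  have IH: "stopping_time F ?\<sigma>" "\<And>\<omega>. \<omega> \<in> space M \<Longrightarrow> 0 \<le> ?\<sigma> \<omega> \<and> ?\<sigma> \<omega> \<le> T" using Suc by auto
  have g: "0 \<le> gamma (N - Suc k + 1)" by (rule gamma_nonneg) simp
  have "stopping_time F (optimal_time T N x (Suc k))"
    using hitting_time_stopping_time[OF IH g] by (simp add: fun_eq_iff[symmetric] optimal_time.simps(2)[abs_def])
  moreover have "0 \<le> optimal_time T N x (Suc k) \<omega> \<and> optimal_time T N x (Suc k) \<omega> \<le> T" if \<omega>: "\<omega> \<in> space M" for \<omega>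
    using first_hitting_time(1,2)[OF continuous_on_subset[OF continuous_paths[OF \<omega>]] _ g, of "?\<sigma> \<omega>"] IH(2)[OF \<omega>]
    by force
  ultimately show ?case by blast
qed

lemma optimal_time_step:
  assumes k: "k < N" and \<omega>: "\<omega> \<in> space M"
  shows "optimal_time T N x k \<omega> \<le> optimal_time T N x (Suc k) \<omega>"
    and "(x (optimal_time T N x (Suc k) \<omega>) \<omega> - x (optimal_time T N x k \<omega>) \<omega>)\<^sup>2
      = gamma (N - k) * (T - optimal_time T N x (Suc k) \<omega>)"
proof -
  have g: "0 \<le> gamma (N - Suc k + 1)" by (rule gamma_nonneg) simp
  have r: "0 \<le> optimal_time T N x k \<omega>" "optimal_time T N x k \<omega> \<le> T"
    using optimal_time_properties[of k N] k \<omega> by auto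
  have cont: "continuous_on {optimal_time T N x k \<omega>..T} (\<lambda>t. x t \<omega>)"
    using continuous_paths[OF \<omega>] r by (auto intro: continuous_on_subset)
  have "N - Suc k + 1 = N - k" using k by simp
  then show "optimal_time T N x k \<omega> \<le> optimal_time T N x (Suc k) \<omega>"
    "(x (optimal_time T N x (Suc k) \<omega>) \<omega> - x (optimal_time T N x k \<omega>) \<omega>)\<^sup>2
      = gamma (N - k) * (T - optimal_time T N x (Suc k) \<omega>)"
    using first_hitting_time(1,3)[OF cont r(2) g] by simp_all
qed

lemma admissible_optimal_time:
  assumes "N \<ge> 1" shows "admissible M T N x (optimal_time T N x)"
  unfolding admissible_def
  using assms optimal_time_properties[of _ N] optimal_time_step(1)[of _ N] by (auto simp del: optimal_time.simps)

text \<open>In stage \<open>i\<close> there are \<open>N - i\<close> samples left, and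
  \<open>stage_cost\<close> writes its cost as a difference of consecutive terms
  \<open>theta (N - i) * B i\<close> plus a weighted squared error. The sum telescopes to an
  equality valid for every admissible policy, so minimising the cost amounts to minimising the
  errors.\<close>

lemma distortion_decomposition:
  assumes N: "N \<ge> 1" and adm: "admissible M T N x \<tau>"
  defines "st \<equiv> sample_time T N \<tau>"
  shows "distortion M T N x \<tau> = theta N * (T\<^sup>2 / 2) + (\<Sum>i<N. (1 - theta (N - i)) / 6 *
    expectation (\<lambda>\<omega>. ((x (st (Suc i) \<omega>) \<omega> - x (st i \<omega>) \<omega>)\<^sup>2 - gamma (N - i) * (T - st (Suc i) \<omega>))\<^sup>2))"
proof -
  have stop: "stopping_time F (st i)" for i
  proof -
    consider "i = 0" | "i \<in> {1..N}" | "N < i" by force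
    then show ?thesis
    proof cases
      case 2
      then have "st i = \<tau> i" by (auto simp: st_def sample_time_def fun_eq_iff)
      then show ?thesis using adm 2 by (auto simp: admissible_def)
    qed (auto simp: st_def sample_time_def[abs_def] stopping_time_const)
  qed
  have mono_\<tau>: "\<tau> i \<omega> \<le> \<tau> j \<omega>" if "\<omega> \<in> space M" "1 \<le> i" "i \<le> j" "j \<le> N" for i j \<omega>
    using that(3,4)
  proof (induction j rule: dec_induct)
    case (step m)
    then have "\<tau> m \<omega> \<le> \<tau> (m + 1) \<omega>" using adm that(1,2) by (auto simp: admissible_def)
    then show ?case using step by simp
  qed simp
  have \<tau>_range: "0 \<le> \<tau> i \<omega>" "\<tau> i \<omega> \<le> T" if "\<omega> \<in> space M" "1 \<le> i" "i \<le> N" for i \<omega>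
    using mono_\<tau>[of \<omega> 1 i] mono_\<tau>[of \<omega> i N] that adm by (auto simp: admissible_def intro: order_trans)
  have range: "0 \<le> st i \<omega> \<and> st i \<omega> \<le> st (Suc i) \<omega> \<and> st (Suc i) \<omega> \<le> T" if "\<omega> \<in> space M" for i \<omega>
    using \<tau>_range[OF that, of i] \<tau>_range[OF that, of "Suc i"] mono_\<tau>[OF that, of i "Suc i"] T_pos
    by (auto simp: st_def sample_time_def)
  define C where "C i \<omega> = integral {st i \<omega>..st (Suc i) \<omega>} (\<lambda>s. (x s \<omega> - x (st i \<omega>) \<omega>)\<^sup>2)" for i \<omega>
  define B where "B i = expectation (\<lambda>\<omega>. (T - st i \<omega>)\<^sup>2 / 2)" for i
  define R where "R i = expectation (\<lambda>\<omega>. ((x (st (Suc i) \<omega>) \<omega> - x (st i \<omega>) \<omega>)\<^sup>2 - gamma (N - i) * (T - st (Suc i) \<omega>))\<^sup>2)" for i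
  have C_int: "integrable M (C i)" for i
    unfolding C_def[abs_def] by (rule optional_stopping(1)[OF stop stop range])
  have C_eq: "(LINT s:{st i \<omega>..st (Suc i) \<omega>}|lborel. (x s \<omega> - x (st i \<omega>) \<omega>)\<^sup>2) = C i \<omega>"
    if \<omega>: "\<omega> \<in> space M" for i \<omega>
  proof -
    have "continuous_on {st i \<omega>..st (Suc i) \<omega>} (\<lambda>s. (x s \<omega> - x (st i \<omega>) \<omega>)\<^sup>2)"
      using range[OF \<omega>, of i]
      by (intro continuous_intros continuous_on_subset[OF continuous_paths[OF \<omega>]]) auto
    from set_borel_integral_eq_integral(2)[OF borel_integrable_atLeastAtMost'[OF this]]
    show ?thesis by (simp add: C_def)
  qed
  have "distortion M T N x \<tau> = expectation (\<lambda>\<omega>. \<Sum>i=0..N. C i \<omega>)"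
    unfolding distortion_def by (intro Bochner_Integration.integral_cong refl sum.cong) (simp add: C_eq flip: st_def)
  also have "\<dots> = (\<Sum>i<Suc N. expectation (C i))"
    using C_int by (simp add: Bochner_Integration.integral_sum atLeast0AtMost lessThan_Suc_atMost)
  also have "\<dots> = (\<Sum>i<N. theta (N - i) * B i - theta (N - Suc i) * B (Suc i) + (1 - theta (N - i)) / 6 * R i) + B N"
  proof -
    have "expectation (C i) = theta (N - i) * B i - theta (N - Suc i) * B (Suc i) + (1 - theta (N - i)) / 6 * R i"
      if "i < N" for i
    proof -
      have Suc: "N - i = Suc (N - Suc i)" using that by simp
      have six: "1 - 6 * ((1 - c) / 6) = c" for c :: real by (simp add: field_simps)
      show ?thesis
        unfolding C_def[abs_def] B_def R_def Suc
        by (rule stage_cost[OF stop stop range theta_gamma_equations[of "N - Suc i"], unfolded six])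
    qed
    moreover have "expectation (C N) = B N"
    proof -
      have "st (Suc N) \<omega> = T" for \<omega> by (simp add: st_def sample_time_def)
      then show ?thesis
        using last_stage_cost[OF stop[of N]] range[of _ N] by (force simp: C_def[abs_def] B_def)
    qed
    ultimately show ?thesis by simp
  qed
  \<comment> \<open>The telescoping sum leaves \<open>- theta 0 * B N\<close>, which the final
    unsampled stage cancels because \<open>theta 0 = 1\<close>.\<close>
  also have "\<dots> = theta N * B 0 + (\<Sum>i<N. (1 - theta (N - i)) / 6 * R i)"
    using sum_lessThan_telescope'[of "\<lambda>i. theta (N - i) * B i" N] by (simp add: sum.distrib)
  also have "B 0 = T\<^sup>2 / 2" by (simp add: B_def st_def sample_time_def prob_space)
  finally show ?thesis unfolding R_def .
qed

end

theorem mainTheorem1: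
  fixes M :: "'a measure" and T x0 :: real and N :: nat and x :: "real \<Rightarrow> 'a \<Rightarrow> real"
  assumes "T > 0" and "N \<ge> 1" and "brownian_motion M T x0 x"
  shows "admissible M T N x (optimal_time T N x)
    \<and> distortion M T N x (optimal_time T N x) = theta N * (T\<^sup>2 / 2)
    \<and> (\<forall>\<tau>. admissible M T N x \<tau> \<longrightarrow> theta N * (T\<^sup>2 / 2) \<le> distortion M T N x \<tau>)"
proof -
  interpret brownian_motion_pos M T x0 x
    using assms by (intro brownian_motion_pos.intro) (auto simp: brownian_motion_pos_axioms_def)
  have adm: "admissible M T N x (optimal_time T N x)"
    using assms(2) by (rule admissible_optimal_time)
  have st: "sample_time T N (optimal_time T N x) i = optimal_time T N x i" if "i \<le> N" for i
    using that by (cases i) (auto simp: sample_time_def fun_eq_iff)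
  \<comment> \<open>Each path meets the threshold with equality at its next sample, also when that
    sample falls at \<open>T\<close>, so the integrand vanishes at every outcome.\<close>
  have "expectation (\<lambda>\<omega>. ((x (sample_time T N (optimal_time T N x) (Suc i) \<omega>) \<omega> - x (sample_time T N (optimal_time T N x) i \<omega>) \<omega>)\<^sup>2
      - gamma (N - i) * (T - sample_time T N (optimal_time T N x) (Suc i) \<omega>))\<^sup>2) = 0" if "i < N" for i
    using that optimal_time_step(2)[OF that]
    by (subst Bochner_Integration.integral_cong[of M M _ "\<lambda>_. 0"]) (simp_all add: st del: optimal_time.simps)
  then have "distortion M T N x (optimal_time T N x) = theta N * (T\<^sup>2 / 2)"
    unfolding distortion_decomposition[OF assms(2) adm] by simp
  moreover have "theta N * (T\<^sup>2 / 2) \<le> distortion M T N x \<tau>" if "admissible M T N x \<tau>" for \<tau>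
    unfolding distortion_decomposition[OF assms(2) that]
    using theta_bounds(2) by (simp add: sum_nonneg)
  ultimately show ?thesis using adm by blast
qed

end
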